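(* Let $X=\mathbb{R}\times\mathbb{T}$, and let $\alpha_{ij}\in\mathrm{Aut}(X)$, where $i,j=1,2,3$. Let $\xi_j$, where $j=1,2,3$, be independent random variables with values in $X$ and distributions $\mu_j$ such that their characteristic functions do not vanish. Assume that the linear statistics $$L_1=\alpha_{11}\xi_1+\alpha_{12}\xi_2+\alpha_{13}\xi_3,\quad L_2=\alpha_{21}\xi_1+\alpha_{22}\xi_2+\alpha_{23}\xi_3,\quad L_3=\alpha_{31}\xi_1+\alpha_{32}\xi_2+\alpha_{33}\xi_3$$ are independent. Then all $\mu_j$ are either degenerate distributions or Gaussian distributions such that their supports are cosets of a subgroup of $X$ topologically isomorphic to $\mathbb{R}$.
   Context: $\mathbb{R}$ is the additive group of real numbers and $\mathbb{T}=\{z\in\mathbb{C}:|z|=1\}$ is the circle group; the group operation of an Abelian group is written additively. For a second countable locally compact Abelian group $X$, $Y$ denotes its character group, $(x,y)$ is the value of the character $y\in Y$ at $x\in X$, and $\mathrm{Aut}(X)$ is the group of topological automorphisms of $X$. The characteristic function of a probability distribution $\mu$ on $X$ is $\widehat\mu(y)=\int_X (x,y)\,d\mu(x)$, $y\in Y$. A distribution is degenerate if it is concentrated at one point. A probability distribution $\gamma$ on $X$ is called Gaussian if $\widehat\gamma(y)=(x,y)\exp\{-\varphi(y)\}$ for all $y\in Y$, where $x\in X$ is a fixed element and $\varphi$ is a continuous nonnegative function on $Y$ satisfying $\varphi(u+v)+\varphi(u-v)=2[\varphi(u)+\varphi(v)]$ for all $u,v\in Y$ (so degenerate distributions are Gaussian).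 *)

theory Defs
  imports "HOL-Probability.Probability"
begin

text \<open>The unit circle of the complex plane as an additively written group, with the subspace
  metric: \<open>x + y\<close> in \<open>circle\<close> is the product of the complex numbers \<open>cval x\<close> and \<open>cval y\<close>.\<close>

typedef circle = "{z :: complex. cmod z = 1}"
  morphisms cval Abs_circle
  by (rule exI[of _ 1]) simp

lemma norm_cval [simp]: "cmod (cval x) = 1"
  using cval[of x] by simp

lemma cval_nonzero [simp]: "cval x \<noteq> 0"
  using norm_cval[of x] by (metis norm_zero zero_neq_one)

lemma cval_Abs_circle [simp]: "cmod z = 1 \<Longrightarrow> cval (Abs_circle z) = z"
  by (simp add: Abs_circle_inverse)

instantiation circle :: ab_group_add
begin

definition zero_circle_def: "0 = Abs_circle 1"
definition plus_circle_def: "x + y = Abs_circle (cval x * cval y)"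
definition uminus_circle_def: "- x = Abs_circle (inverse (cval x))"
definition minus_circle_def: "x - y = Abs_circle (cval x / cval y)"

instance
proof
  fix a b c :: circle
  show "a + b + c = a + (b + c)"
    by (simp add: plus_circle_def norm_mult mult.assoc)
  show "a + b = b + a"
    by (simp add: plus_circle_def mult.commute)
  show "0 + a = a"
    by (simp add: zero_circle_def plus_circle_def cval_inverse)
  show "- a + a = 0"
    by (simp add: zero_circle_def plus_circle_def uminus_circle_def norm_inverse)
  show "a - b = a + - b"
    by (simp add: plus_circle_def uminus_circle_def minus_circle_def norm_inverse divide_inverse)
qed

end

lemma cval_zero [simp]: "cval 0 = 1"
  and cval_plus [simp]: "cval (x + y) = cval x * cval y"
  and cval_uminus [simp]: "cval (- x) = inverse (cval x)"
  and cval_minus [simp]: "cval (x - y) = cval x / cval y"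
  by (simp_all add: zero_circle_def plus_circle_def uminus_circle_def minus_circle_def
      norm_mult norm_inverse norm_divide)

instantiation circle :: metric_space
begin

definition dist_circle_def: "dist x y = dist (cval x) (cval y)"
definition uniformity_circle_def:
  "(uniformity :: (circle \<times> circle) filter) = (INF e\<in>{0<..}. principal {(x, y). dist x y < e})"
definition open_circle_def:
  "open (U :: circle set) \<longleftrightarrow> (\<forall>x\<in>U. \<forall>\<^sub>F (x', y) in uniformity. x' = x \<longrightarrow> y \<in> U)"

instance
proof
  fix x y z :: circle
  show "dist x y = 0 \<longleftrightarrow> x = y"
    by (simp add: dist_circle_def cval_inject)
  show "dist x y \<le> dist x z + dist y z"
    by (simp add: dist_circle_def dist_triangle2)
qed (simp_all only: uniformity_circle_def open_circle_def)

end

lemma tendsto_circle_iff: "(f \<longlongrightarrow> l) F \<longleftrightarrow> ((\<lambda>x. cval (f x)) \<longlongrightarrow> cval l) F"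
  by (simp add: tendsto_iff dist_circle_def)

lemma open_circle_iff: "open U \<longleftrightarrow> (\<exists>V. open V \<and> U = cval -` V)"
proof
  assume "open U"
  then have "\<forall>x\<in>U. \<exists>e>0. \<forall>y. dist (cval y) (cval x) < e \<longrightarrow> y \<in> U"
    by (simp add: open_dist dist_circle_def)
  then obtain e where e: "\<And>x. x \<in> U \<Longrightarrow> e x > 0"
    "\<And>x y. x \<in> U \<Longrightarrow> dist (cval y) (cval x) < e x \<Longrightarrow> y \<in> U"
    by metis
  have "U = cval -` (\<Union>x\<in>U. ball (cval x) (e x))"
  proof (rule set_eqI)
    show "x \<in> U \<longleftrightarrow> x \<in> cval -` (\<Union>x\<in>U. ball (cval x) (e x))" for x
      using e(1)[of x] e(2)[of _ x] by (auto simp: dist_commute[of "cval x"] intro!: bexI[of _ x])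
  qed
  moreover have "open (\<Union>x\<in>U. ball (cval x) (e x))"
    by (intro open_UN ballI open_ball)
  ultimately show "\<exists>V. open V \<and> U = cval -` V"
    by (intro exI conjI)
next
  assume "\<exists>V. open V \<and> U = cval -` V"
  then obtain V where V: "open V" "U = cval -` V"
    by blast
  show "open U"
    unfolding open_dist
  proof
    fix x assume "x \<in> U"
    with V obtain e where "e > 0" "\<forall>z. dist z (cval x) < e \<longrightarrow> z \<in> V"
      by (auto simp: open_dist)
    with V show "\<exists>e>0. \<forall>y. dist y x < e \<longrightarrow> y \<in> U"
      by (auto simp: dist_circle_def)
  qed
qed

instance circle :: second_countable_topology
proof
  obtain B :: "complex set set" where B: "countable B" "topological_basis B"
    using ex_countable_basis by blast
  have "topological_basis ((-`) cval ` B)"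
    unfolding topological_basis_def
  proof (intro conjI allI impI ballI)
    fix U assume "U \<in> (-`) cval ` B"
    then show "open U"
      using topological_basis_open[OF B(2)] by (auto simp: open_circle_iff)
  next
    fix U :: "circle set" assume "open U"
    then obtain V where V: "open V" "U = cval -` V"
      by (auto simp: open_circle_iff)
    then obtain C where "C \<subseteq> B" "\<Union>C = V"
      using B(2) by (auto simp: topological_basis_def)
    with V show "\<exists>B'\<subseteq>(-`) cval ` B. \<Union>B' = U"
      by (intro exI[of _ "(-`) cval ` C"]) auto
  qed
  then show "\<exists>B :: circle set set. countable B \<and> open = generate_topology B"
    using B(1) by (intro exI[of _ "(-`) cval ` B"] conjI countable_image topological_basis_imp_subbasis)
qed

instance circle :: topological_ab_group_add
proof
  show "((\<lambda>x. fst x + snd x) \<longlongrightarrow> a + b) (nhds a \<times>\<^sub>F nhds b)" for a b :: circle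
  proof -
    have "((\<lambda>x. fst x) \<longlongrightarrow> a) (nhds a \<times>\<^sub>F nhds b)" "((\<lambda>x. snd x) \<longlongrightarrow> b) (nhds a \<times>\<^sub>F nhds b)"
      by (auto intro: filterlim_fst filterlim_snd)
    then show ?thesis
      unfolding tendsto_circle_iff cval_plus by (rule tendsto_mult)
  qed
  show "(uminus \<longlongrightarrow> - a) (nhds a)" for a :: circle
  proof -
    have "((\<lambda>x. x) \<longlongrightarrow> a) (nhds a)"
      by (simp add: filterlim_ident)
    then show ?thesis
      unfolding tendsto_circle_iff cval_uminus by (rule tendsto_inverse) simp
  qed
qed

instance prod :: (topological_monoid_add, topological_monoid_add) topological_monoid_add
proof
  fix a b :: "'a \<times> 'b"
  have "((\<lambda>x. fst x) \<longlongrightarrow> a) (nhds a \<times>\<^sub>F nhds b)" "((\<lambda>x. snd x) \<longlongrightarrow> b) (nhds a \<times>\<^sub>F nhds b)"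
    by (auto intro: filterlim_fst filterlim_snd)
  then have "((\<lambda>x. (fst (fst x) + fst (snd x), snd (fst x) + snd (snd x)))
      \<longlongrightarrow> (fst a + fst b, snd a + snd b)) (nhds a \<times>\<^sub>F nhds b)"
    by (intro tendsto_Pair tendsto_add tendsto_fst tendsto_snd)
  then show "((\<lambda>x. fst x + snd x) \<longlongrightarrow> a + b) (nhds a \<times>\<^sub>F nhds b)"
    by (simp only: plus_prod_def)
qed

instance prod :: (topological_group_add, topological_group_add) topological_group_add
proof
  fix a :: "'a \<times> 'b"
  have "((\<lambda>x. x) \<longlongrightarrow> a) (nhds a)"
    by (simp add: filterlim_ident)
  then have "((\<lambda>x. (- fst x, - snd x)) \<longlongrightarrow> (- fst a, - snd a)) (nhds a)"
    by (intro tendsto_Pair tendsto_minus tendsto_fst tendsto_snd)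
  then show "(uminus \<longlongrightarrow> - a) (nhds a)"
    by (simp only: uminus_prod_def[abs_def])
qed

instance prod :: (topological_ab_group_add, topological_ab_group_add) topological_ab_group_add ..

definition topological_Aut :: "('a::topological_ab_group_add \<Rightarrow> 'a) set" where
  "topological_Aut = {f. Modules.additive f \<and> (\<exists>g. homeomorphism UNIV UNIV f g)}"

definition characters :: "('a::topological_ab_group_add \<Rightarrow> circle) set" where
  "characters = {y. Modules.additive y \<and> continuous_on UNIV y}"

definition compact_open_topology ::
    "('a::topological_space \<Rightarrow> 'b::topological_space) topology" where
  "compact_open_topology =
     topology_generated_by {{f. continuous_on UNIV f \<and> f ` K \<subseteq> U} | K U. compact K \<and> open U}"

text \<open>The character group: its group operation is pointwise addition in \<open>circle\<close>.\<close>

definition character_topology :: "('a::topological_ab_group_add \<Rightarrow> circle) topology" where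
  "character_topology = subtopology compact_open_topology characters"

lemma topspace_character_topology: "topspace character_topology = characters"
proof -
  have "characters \<subseteq> topspace (compact_open_topology :: ('a \<Rightarrow> circle) topology)"
  proof
    fix f :: "'a \<Rightarrow> circle" assume "f \<in> characters"
    then have "f \<in> {f. continuous_on UNIV f \<and> f ` {} \<subseteq> UNIV}"
      by (simp add: characters_def)
    moreover have "{f :: 'a \<Rightarrow> circle. continuous_on UNIV f \<and> f ` {} \<subseteq> UNIV}
        \<in> {{f. continuous_on UNIV f \<and> f ` K \<subseteq> U} | K U. compact K \<and> open U}"
      by (rule CollectI, rule exI[of _ "{}"], rule exI[of _ UNIV])
        (intro conjI refl compact_empty open_UNIV)
    ultimately show "f \<in> topspace compact_open_topology"
      unfolding compact_open_topology_def topology_generated_by_topspace by (rule UnionI[rotated])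
  qed
  then show ?thesis
    unfolding character_topology_def topspace_subtopology by (rule Int_absorb1)
qed

definition add_subgroup :: "'a::ab_group_add set \<Rightarrow> bool" where
  "add_subgroup G \<longleftrightarrow> 0 \<in> G \<and> (\<forall>x\<in>G. \<forall>y\<in>G. x + y \<in> G) \<and> (\<forall>x\<in>G. - x \<in> G)"

definition topologically_isomorphic ::
    "'a::topological_ab_group_add set \<Rightarrow> 'b::topological_ab_group_add set \<Rightarrow> bool" where
  "topologically_isomorphic G H \<longleftrightarrow>
     (\<exists>f g. homeomorphism G H f g \<and> (\<forall>x\<in>G. \<forall>y\<in>G. f (x + y) = f x + f y))"

definition is_coset_of :: "'a::ab_group_add set \<Rightarrow> 'a set \<Rightarrow> bool" where
  "is_coset_of S G \<longleftrightarrow> (\<exists>x. S = (\<lambda>g. x + g) ` G)"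

text \<open>The definitions below are meant for Borel probability measures \<open>\<mu>\<close>.\<close>

definition char_function ::
    "'a::topological_ab_group_add measure \<Rightarrow> ('a \<Rightarrow> circle) \<Rightarrow> complex" where
  "char_function \<mu> y = (LINT x|\<mu>. cval (y x))"

definition degenerate :: "'a::topological_space measure \<Rightarrow> bool" where
  "degenerate \<mu> \<longleftrightarrow> (\<exists>x. measure \<mu> {x} = 1)"

definition gaussian :: "'a::topological_ab_group_add measure \<Rightarrow> bool" where
  "gaussian \<mu> \<longleftrightarrow>
     (\<exists>x \<phi>. continuous_map character_topology euclideanreal \<phi> \<and>
            (\<forall>y\<in>characters. \<phi> y \<ge> 0) \<and>
            (\<forall>u\<in>characters. \<forall>v\<in>characters.
               \<phi> (\<lambda>t. u t + v t) + \<phi> (\<lambda>t. u t - v t) = 2 * (\<phi> u + \<phi> v)) \<and>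
            (\<forall>y\<in>characters.
               char_function \<mu> y = cval (y x) * complex_of_real (exp (- \<phi> y))))"

definition measure_support :: "'a::topological_space measure \<Rightarrow> 'a set" where
  "measure_support \<mu> = {x. \<forall>U. open U \<and> x \<in> U \<longrightarrow> emeasure \<mu> U > 0}"

end

theory Submission
  imports Defs
begin

text \<open>
  Identify the character group of \<open>\<real> \<times> \<bbbT>\<close> with \<open>\<real> \<times> \<int>\<close>. Independence turns into the equation
  \<open>\<Prod>\<^sub>j \<phi>\<^sub>j (\<Sum>\<^sub>i A\<^sub>i\<^sub>j u\<^sub>i) = \<Prod>\<^sub>i \<Prod>\<^sub>j \<phi>\<^sub>j (A\<^sub>i\<^sub>j u\<^sub>i)\<close> with \<open>A\<^sub>i\<^sub>j (s, n) = (a\<^sub>i\<^sub>j s + b\<^sub>i\<^sub>j n, \<plusminus>n)\<close>.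
  If the real matrix \<open>(a\<^sub>i\<^sub>j)\<close> is singular, a kernel vector shows \<open>\<bar>\<phi>\<^sub>j\<bar> = 1\<close> on \<open>\<real> \<times> {0}\<close> for all \<open>j\<close>.
  If it is invertible, one may move the arguments so that only one factor on the left changes, and
  therefore \<open>ln \<bar>\<phi>\<^sub>j\<bar>\<close> is \<open>- \<sigma>\<^sub>j s\<^sup>2\<close> on \<open>\<real> \<times> {0}\<close> and \<open>g\<^sub>j - \<sigma>\<^sub>j (s + c\<^sub>j n)\<^sup>2\<close> for \<open>n = \<plusminus>1\<close>, where the \<open>\<sigma>\<^sub>j\<close>
  are all zero or all positive.

  It remains to see \<open>g\<^sub>j = 0\<close>. There are four patterns of three signs modulo a common sign but only
  three columns in the matrix of signs of the \<open>A\<^sub>i\<^sub>j\<close>, so signs \<open>n\<^sub>i\<close> exist with \<open>\<Sum>\<^sub>i \<plusminus>n\<^sub>i = \<plusminus>1\<close> for each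
  column \<open>j\<close>. Choosing the real coordinates so that all factors on the left are at their maxima
  yields \<open>\<Sum>\<^sub>j g\<^sub>j \<le> 3 \<Sum>\<^sub>j g\<^sub>j\<close>, and \<open>g\<^sub>j \<le> 0\<close>. Thus \<open>\<mu>\<^sub>j\<close> is concentrated on a coset of the helix
  \<open>{(t, exp (\<i> c\<^sub>j t))}\<close> and its projection to \<open>\<real>\<close> is a point mass or Gaussian.
\<close>

subsection \<open>Characters and automorphisms\<close>

text \<open>Additivity gives homogeneity over the integers, hence over the rationals; continuity
  carries the identity over from this dense set.\<close>

lemma additive_continuous_real_linear:
  fixes f :: "real \<Rightarrow> real"
  assumes add: "\<And>x y. f (x + y) = f x + f y" and cont: "continuous_on UNIV f"
  shows "f x = x * f 1"
proof -
  interpret additive f by unfold_locales (rule add)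
  have nat: "f (of_nat n * y) = of_nat n * f y" for n y
    by (induction n) (simp_all add: zero add distrib_right)
  have int: "f (of_int k * y) = of_int k * f y" for k y
    by (cases k) (use nat minus in \<open>simp_all del: of_nat_Suc\<close>)
  have rat: "f q = q * f 1" if "q \<in> \<rat>" for q
  proof -
    from that obtain a b where "q = of_int a / of_int b" and b: "b > 0"
      by (rule Rats_cases')
    then have "of_int b * f q = f (of_int a * 1)"
      using int[of b q] by simp
    then show ?thesis
      using b by (simp only: int \<open>q = _\<close>) (simp add: field_simps)
  qed
  have "f x - x * f 1 = 0"
  proof (rule continuous_constant_on_closure[where S = \<rat> and f = "\<lambda>x. f x - x * f 1"])
    show "continuous_on (closure \<rat>) (\<lambda>x. f x - x * f 1)"
      by (intro continuous_intros continuous_on_subset[OF cont]) simp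
    show "q \<in> \<rat> \<Longrightarrow> f q - q * f 1 = 0" for q
      using rat[of q] by simp
  qed (simp add: Rats_closure_real)
  then show ?thesis by simp
qed

lemma continuous_biadditive_real:
  fixes b :: "real \<Rightarrow> real \<Rightarrow> real"
  assumes "\<And>x y z. b (x + y) z = b x z + b y z" "\<And>x y z. b z (x + y) = b z x + b z y"
    and "\<And>z. continuous_on UNIV (\<lambda>x. b x z)" "\<And>z. continuous_on UNIV (b z)"
  shows "b x y = x * y * b 1 1"
  using additive_continuous_real_linear[of "\<lambda>x. b x y" x]
    additive_continuous_real_linear[of "b 1" y] assms by simp

text \<open>The line is contractible, so \<open>h\<close> has a continuous logarithm, purely
  imaginary because \<open>h\<close> has modulus one. Its phase, normalised to vanish at 0, turns
  out to be additive and therefore linear.\<close>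

lemma continuous_hom_real_circle:
  fixes h :: "real \<Rightarrow> complex"
  assumes mult: "\<And>x y. h (x + y) = h x * h y" and cont: "continuous_on UNIV h"
    and norm: "\<And>x. cmod (h x) = 1"
  obtains s where "\<And>x. h x = cis (s * x)"
proof -
  have "contractible (UNIV :: real set)"
    by (simp add: convex_imp_contractible)
  moreover have "h z \<noteq> 0" for z
    using norm[of z] by auto
  ultimately obtain g where g: "continuous_on UNIV g" "\<And>x. h x = exp (g x)"
    using continuous_logarithm_on_contractible[OF cont] by auto
  have Re: "Re (g x) = 0" for x
    using norm[of x] by (simp add: g)
  define p where "p x = Im (g x) - Im (g 0)" for x
  have p: "continuous_on UNIV p"
    unfolding p_def by (intro continuous_intros g)
  have "h 0 = 1"
    using mult[of 0 0] \<open>h 0 \<noteq> 0\<close> by simp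
  have h: "h x = cis (p x)" for x
  proof -
    have "h x = cis (Im (g x))" for x
      by (simp add: g(2) exp_eq_polar Re)
    then show ?thesis
      using \<open>h 0 = 1\<close> by (simp add: p_def flip: cis_divide)
  qed
  have "p (x + y) = p x + p y" for x y
  proof -
    \<comment> \<open>The defect of additivity is continuous with values in the multiples of
      \<open>2 * pi\<close>, so it is constant; its value at \<open>t = 0\<close> is 0.\<close>
    define d where "d t = p (x + t) - p x - p t" for t
    have "continuous_on UNIV d"
      unfolding d_def by (intro continuous_intros continuous_on_compose2[OF p]) auto
    have d: "\<exists>n::int. d t = 2 * pi * of_int n" for t
    proof -
      have "cis (d t) = 1"
        using mult[of x t] by (simp add: d_def h flip: cis_divide)
      then have "cos (d t) = 1"
        by (simp add: complex_eq_iff)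
      then show ?thesis
        by (auto simp: cos_one_2pi_int)
    qed
    have "d constant_on UNIV"
    proof (rule continuous_discrete_range_constant)
      show "connected (UNIV :: real set)" by simp
      show "continuous_on UNIV d" by fact
      show "\<exists>e>0. \<forall>v. v \<in> UNIV \<and> d v \<noteq> d u \<longrightarrow> e \<le> norm (d v - d u)" for u
      proof (intro exI conjI allI impI)
        fix v assume "v \<in> UNIV \<and> d v \<noteq> d u"
        moreover obtain m n where mn: "d v = 2 * pi * of_int m" "d u = 2 * pi * of_int n"
          using d by meson
        ultimately have "\<bar>m - n\<bar> \<ge> 1" by auto
        then have "real_of_int \<bar>m - n\<bar> \<ge> 1" by linarith
        then have "2 * pi * 1 \<le> 2 * pi * real_of_int \<bar>m - n\<bar>"
          by (intro mult_left_mono) auto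
        also have "\<dots> = \<bar>2 * pi * (real_of_int m - real_of_int n)\<bar>"
          by (simp add: abs_mult)
        also have "2 * pi * (real_of_int m - real_of_int n) = d v - d u"
          by (simp add: mn algebra_simps)
        finally show "2 * pi \<le> norm (d v - d u)" by simp
      qed simp
    qed
    then have "d y = d 0" by (auto simp: constant_on_def)
    then show ?thesis by (simp add: d_def p_def)
  qed
  then have "p x = x * p 1" for x
    by (rule additive_continuous_real_linear[OF _ p])
  then show thesis
    using that[of "p 1"] h by (metis mult.commute)
qed

section \<open>Characters as pairs of a real and an integer frequency\<close>

lemma continuous_on_cval: "continuous_on UNIV cval"
  by (simp add: continuous_on_def flip: tendsto_circle_iff)

lemma continuous_on_circle_iff: "continuous_on S f \<longleftrightarrow> continuous_on S (\<lambda>x. cval (f x))"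
  by (simp add: continuous_on_def tendsto_circle_iff)

definition chi :: "real \<Rightarrow> int \<Rightarrow> real \<times> circle \<Rightarrow> circle" where
  "chi s n p = Abs_circle (cis (s * fst p) * cval (snd p) powi n)"

lemma cval_chi [simp]: "cval (chi s n p) = cis (s * fst p) * cval (snd p) powi n"
  by (simp add: chi_def norm_mult norm_power_int)

lemma circle_eqI: "cval x = cval y \<Longrightarrow> x = y"
  by (simp add: cval_inject)

lemma additive_cval:
  assumes "Modules.additive y"
  shows "cval (y (p + q)) = cval (y p) * cval (y q)"
  using additive.add[OF assms, of p q] by simp

lemma chi_add: "chi (s + t) (m + n) p = chi s m p + chi t n p"
  by (rule circle_eqI) (simp add: power_int_add distrib_right flip: cis_mult)

lemma chi_minus: "chi (s - t) (m - n) p = chi s m p - chi t n p"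
  by (rule circle_eqI) (simp add: power_int_diff left_diff_distrib flip: cis_divide)

lemma chi_in_characters: "chi s n \<in> characters"
proof -
  have "Modules.additive (chi s n)"
    by unfold_locales (rule circle_eqI, simp add: power_int_mult_distrib distrib_left flip: cis_mult)
  moreover have "continuous_on UNIV (chi s n)"
    unfolding continuous_on_circle_iff cval_chi
    by (intro continuous_intros continuous_on_compose2[OF continuous_on_cval]) auto
  ultimately show ?thesis by (simp add: characters_def)
qed

lemma circle_cases: obtains t where "x = Abs_circle (cis t)"
  using that[of "Arg (cval x)"] by (simp add: cis_Arg sgn_eq cval_inverse)

lemma Abs_circle_cis_add: "Abs_circle (cis (s + t)) = Abs_circle (cis s) + Abs_circle (cis t)"
  by (rule circle_eqI) (simp add: cis_mult)

lemma continuous_on_Abs_circle_cis: "continuous_on UNIV (\<lambda>t. Abs_circle (cis t))"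
  by (simp add: continuous_on_circle_iff continuous_intros)

text \<open>A character is the product of its restrictions to the two factors. The restriction to
  the circle is pulled back to the line by \<open>cis\<close>, and its period \<open>2 * pi\<close>
  forces an integer frequency.\<close>

lemma characters_cases:
  assumes "y \<in> characters"
  obtains s n where "y = chi s n"
proof -
  have add: "Modules.additive y" and cont: "continuous_on UNIV y"
    using assms by (auto simp: characters_def)
  note mult = additive_cval[OF add]
  have cont': "continuous_on UNIV (\<lambda>t. cval (y (f t)))" if "continuous_on UNIV f" for f :: "real \<Rightarrow> _"
    using that by (intro continuous_on_compose2[OF continuous_on_cval]
      continuous_on_compose2[OF cont]) auto
  obtain s where s: "\<And>t. cval (y (t, 0)) = cis (s * t)"
  proof (rule continuous_hom_real_circle[of "\<lambda>t. cval (y (t, 0))"])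
    show "cval (y (u + v, 0)) = cval (y (u, 0)) * cval (y (v, 0))" for u v
      using mult[of "(u, 0)" "(v, 0)"] by simp
    show "continuous_on UNIV (\<lambda>t. cval (y (t, 0)))"
      by (intro cont' continuous_intros)
  qed auto
  obtain c where c: "\<And>t. cval (y (0, Abs_circle (cis t))) = cis (c * t)"
  proof (rule continuous_hom_real_circle[of "\<lambda>t. cval (y (0, Abs_circle (cis t)))"])
    show "cval (y (0, Abs_circle (cis (u + v)))) =
        cval (y (0, Abs_circle (cis u))) * cval (y (0, Abs_circle (cis v)))" for u v
      using mult[of "(0, Abs_circle (cis u))" "(0, Abs_circle (cis v))"]
      by (simp add: Abs_circle_cis_add)
    show "continuous_on UNIV (\<lambda>t. cval (y (0, Abs_circle (cis t))))"
      by (intro cont' continuous_intros continuous_on_Abs_circle_cis)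
  qed auto
  have "cis (c * (2 * pi)) = cis (c * 0)"
    using c[of "2 * pi"] c[of 0] by simp
  then have "cos (2 * pi * c) = 1"
    by (simp add: complex_eq_iff mult.commute mult.left_commute)
  then obtain n :: int where n: "c = of_int n"
    by (auto simp: cos_one_2pi_int)
  have "y p = chi s n p" for p
  proof (rule circle_eqI)
    obtain t where t: "snd p = Abs_circle (cis t)"
      by (rule circle_cases)
    have "cval (y p) = cval (y (fst p, 0)) * cval (y (0, snd p))"
      using mult[of "(fst p, 0)" "(0, snd p)"] by simp
    also have "\<dots> = cval (chi s n p)"
      by (simp add: s c t n cis_power_int mult.commute)
    finally show "cval (y p) = cval (chi s n p)" .
  qed
  then show thesis
    using that by blast
qed

text \<open>The second component of \<open>f\<close> is a character. The first component vanishes on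
  the circle: pulled back to the line it is linear and takes the same value at 0 and
  \<open>2 * pi\<close>.\<close>

lemma continuous_additive_real_circle:
  fixes f :: "real \<times> circle \<Rightarrow> real \<times> circle"
  assumes add: "Modules.additive f" and cont: "continuous_on UNIV f"
  obtains a b e where "\<And>p. f p = (a * fst p, chi b e p)"
proof -
  note plus = additive.add[OF add]
  have "(\<lambda>p. snd (f p)) \<in> characters"
    unfolding characters_def using cont
    by (auto intro!: continuous_on_snd additive.intro simp only: plus snd_add)
  then obtain b e where "(\<lambda>p. snd (f p)) = chi b e"
    by (rule characters_cases)
  then have snd: "snd (f p) = chi b e p" for p
    by (rule fun_cong)
  have cont': "continuous_on UNIV (\<lambda>t. fst (f (g t)))" if "continuous_on UNIV g" for g :: "real \<Rightarrow> _"
    using that by (intro continuous_on_fst continuous_on_compose2[OF cont]) auto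
  have R: "fst (f (t, 0)) = t * fst (f (1, 0))" for t
  proof (rule additive_continuous_real_linear)
    show "fst (f (u + v, 0)) = fst (f (u, 0)) + fst (f (v, 0))" for u v
      using plus[of "(u, 0)" "(v, 0)"] by simp
    show "continuous_on UNIV (\<lambda>t. fst (f (t, 0)))"
      by (intro cont' continuous_intros)
  qed
  define k where "k t = fst (f (0, Abs_circle (cis t)))" for t
  have k: "k t = t * k 1" for t
  proof (rule additive_continuous_real_linear)
    show "k (u + v) = k u + k v" for u v
      using plus[of "(0, Abs_circle (cis u))" "(0, Abs_circle (cis v))"]
      by (simp add: k_def Abs_circle_cis_add)
    show "continuous_on UNIV k"
      unfolding k_def by (intro cont' continuous_intros continuous_on_Abs_circle_cis)
  qed
  have "k (2 * pi) = k 0"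
    by (simp add: k_def)
  then have "k 1 = 0"
    using k[of "2 * pi"] k[of 0] by simp
  have T: "fst (f (0, z)) = 0" for z
  proof -
    obtain t where "z = Abs_circle (cis t)"
      by (rule circle_cases)
    then show ?thesis
      using k[of t] \<open>k 1 = 0\<close> by (simp add: k_def)
  qed
  have "f p = (fst (f (1, 0)) * fst p, chi b e p)" for p
  proof (rule prod_eqI)
    show "fst (f p) = fst (fst (f (1, 0)) * fst p, chi b e p)"
      using plus[of "(fst p, 0)" "(0, snd p)"] R[of "fst p"] T[of "snd p"] by (simp add: mult.commute)
  qed (simp add: snd)
  then show thesis
    by (rule that)
qed

text \<open>The inverse has the same triangular form. Composing the two gives
  \<open>a * a' = 1\<close> over the reals and \<open>e * e' = 1\<close> over the integers.\<close>

lemma topological_Aut_real_circle: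
  fixes f :: "real \<times> circle \<Rightarrow> real \<times> circle"
  assumes "f \<in> topological_Aut"
  shows "\<exists>a b e. a \<noteq> 0 \<and> (e = 1 \<or> e = - 1) \<and> (\<forall>p. f p = (a * fst p, chi b e p))"
proof -
  from assms obtain g where add: "Modules.additive f" and hom: "homeomorphism UNIV UNIV f g"
    by (auto simp: topological_Aut_def)
  have fg: "f (g p) = p" and gf: "g (f p) = p" for p
    using homeomorphism_apply1[OF hom] homeomorphism_apply2[OF hom] by auto
  obtain a b e where f: "\<And>p. f p = (a * fst p, chi b e p)"
    using continuous_additive_real_circle[OF add homeomorphism_cont1[OF hom]] by blast
  have "Modules.additive g"
    by (intro additive.intro) (metis fg gf additive.add[OF add])
  then obtain a' b' e' where g: "\<And>p. g p = (a' * fst p, chi b' e' p)"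
    using continuous_additive_real_circle[OF _ homeomorphism_cont2[OF hom]] by blast
  have "a * a' = 1"
    using arg_cong[OF fg[of "(1, 0)"], of fst] by (simp add: f g)
  then have "a \<noteq> 0"
    by auto
  have "e * e' = 1"
  proof (rule ccontr)
    assume ne: "e * e' \<noteq> 1"
    \<comment> \<open>At this angle \<open>e * e' * t\<close> and \<open>t\<close> differ by exactly
      \<open>pi\<close>, whereas the composition being the identity would make them equal modulo
      \<open>2 * pi\<close>.\<close>
    define t where "t = pi / (of_int (e * e') - 1)"
    have "cis (of_int (e * e') * t) = cis t"
      using arg_cong[OF fg[of "(0, Abs_circle (cis t))"], of "\<lambda>p. cval (snd p)"]
      by (simp add: f g cis_power_int mult.assoc)
    then have "cis (of_int (e * e') * t - t) = 1"
      by (simp flip: cis_divide)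
    moreover have "of_int (e * e') - 1 \<noteq> (0 :: real)"
      using ne by (metis of_int_1 of_int_diff of_int_eq_0_iff eq_iff_diff_eq_0)
    then have "(of_int (e * e') - 1) * t = pi"
      by (simp only: t_def times_divide_eq_right nonzero_mult_div_cancel_left simp_thms)
    then have "of_int (e * e') * t - t = pi"
      by (simp only: left_diff_distrib mult_1)
    ultimately have "cis pi = 1"
      by (simp only:)
    then show False
      by simp
  qed
  then have "e = 1 \<or> e = - 1"
    by (auto simp: zmult_eq_1_iff)
  with \<open>a \<noteq> 0\<close> f show ?thesis
    by (intro exI[of _ a] exI[of _ b] exI[of _ e] conjI allI)
qed

subsection \<open>Characteristic functions\<close>

lemma cnj_cval: "cnj (cval x) = cval (- x)"
proof -
  have "cval x * cnj (cval x) = 1"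
    using complex_norm_square[of "cval x"] by simp
  then show ?thesis
    by (simp add: inverse_unique)
qed

text \<open>Equality case of the triangle inequality: after rotation by the conjugate of the mean
  \<open>w\<close>, the function \<open>1 - Re (cnj w * X x)\<close> is nonnegative with integral
  zero.\<close>

lemma norm_one_integral_AE:
  fixes X :: "'a \<Rightarrow> complex"
  assumes "prob_space M" and X: "X \<in> borel_measurable M" "\<And>x. cmod (X x) = 1"
    and 1: "cmod (LINT x|M. X x) = 1"
  shows "AE x in M. X x = (LINT x|M. X x)"
proof -
  interpret prob_space M by fact
  define w where "w = (LINT x|M. X x)"
  have int: "integrable M X"
    by (rule integrable_const_bound[where B = 1]) (use X in auto)
  have ww: "cnj w * w = 1"
    using 1 by (simp add: w_def mult.commute[of "cnj _"] flip: complex_norm_square)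
  have "(LINT x|M. Re (cnj w * X x)) = Re (LINT x|M. cnj w * X x)"
    using int by (intro integral_Re) simp
  also have "\<dots> = 1"
    using int ww by (simp add: w_def)
  finally have "(LINT x|M. 1 - Re (cnj w * X x)) = 0"
    using int by (subst Bochner_Integration.integral_diff) (auto simp: prob_space)
  have le: "Re (cnj w * X x) \<le> 1" for x
    using complex_Re_le_cmod[of "cnj w * X x"] X(2)[of x] 1 by (simp add: norm_mult w_def)
  then have "AE x in M. 1 - Re (cnj w * X x) = 0"
    using \<open>(LINT x|M. 1 - Re (cnj w * X x)) = 0\<close> int
    by (subst (asm) integral_nonneg_eq_0_iff_AE) auto
  then have "AE x in M. X x = w"
  proof eventually_elim
    case (elim x)
    have "cmod (cnj w * X x) = 1"
      using X(2)[of x] 1 by (simp add: norm_mult w_def)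
    with elim have "cnj w * X x = 1"
      by (auto simp: complex_eq_iff cmod_def)
    have "X x = (cnj w * w) * X x"
      using ww by simp
    also have "\<dots> = w * (cnj w * X x)"
      by (simp only: mult.assoc mult.left_commute)
    finally show ?case
      using \<open>cnj w * X x = 1\<close> by simp
  qed
  then show ?thesis
    by (simp add: w_def)
qed

lemma measurable_cval_chi [measurable]: "(\<lambda>p. cval (chi s n p)) \<in> borel_measurable borel"
proof (rule borel_measurable_continuous_onI)
  show "continuous_on UNIV (\<lambda>p. cval (chi s n p))"
    using chi_in_characters[of s n]
    by (simp only: characters_def mem_Collect_eq flip: continuous_on_circle_iff)
qed

definition cf :: "(real \<times> circle) measure \<Rightarrow> real \<Rightarrow> int \<Rightarrow> complex" where
  "cf \<mu> s n = char_function \<mu> (chi s n)"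

locale real_circle_distribution = prob_space \<mu> for \<mu> :: "(real \<times> circle) measure" +
  assumes sets_eq [simp, measurable_cong]: "sets \<mu> = sets borel"
begin

lemma cf_eq: "cf \<mu> s n = (LINT p|\<mu>. cval (chi s n p))"
  by (simp add: cf_def char_function_def)

lemma cf_0_0 [simp]: "cf \<mu> 0 0 = 1"
  by (simp add: cf_eq prob_space)

lemma norm_cf_le: "cmod (cf \<mu> s n) \<le> 1"
  using integral_norm_bound[of \<mu> "\<lambda>p. cval (chi s n p)"]
  unfolding cf_eq by (simp only: norm_cval) (simp add: prob_space)

lemma cf_minus: "cf \<mu> (- s) (- n) = cnj (cf \<mu> s n)"
proof -
  have "chi (- s) (- n) p = - chi s n p" for p
    by (rule circle_eqI) (simp add: power_int_minus cis_inverse)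
  then have "cval (chi (- s) (- n) p) = cnj (cval (chi s n p))" for p
    by (simp only: cnj_cval)
  then show ?thesis
    unfolding cf_eq by (simp only: Bochner_Integration.integral_cnj)
qed

lemma continuous_on_cf: "continuous_on UNIV (\<lambda>s. cf \<mu> s n)"
  unfolding continuous_on_sequentially
proof (intro allI ballI impI)
  fix x :: "nat \<Rightarrow> real" and a :: real
  assume "a \<in> UNIV" and "(\<forall>k. x k \<in> UNIV) \<and> x \<longlonglongrightarrow> a"
  then have x: "x \<longlonglongrightarrow> a" by simp
  have "(\<lambda>k. LINT p|\<mu>. cval (chi (x k) n p)) \<longlonglongrightarrow> (LINT p|\<mu>. cval (chi a n p))"
  proof (rule integral_dominated_convergence[where w = "\<lambda>_. 1"])
    show "AE p in \<mu>. (\<lambda>k. cval (chi (x k) n p)) \<longlonglongrightarrow> cval (chi a n p)"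
      unfolding cval_chi by (intro AE_I2 tendsto_intros x)
  qed (auto simp del: cval_chi)
  then show "((\<lambda>s. cf \<mu> s n) \<circ> x) \<longlonglongrightarrow> cf \<mu> a n"
    by (simp add: cf_eq o_def)
qed

lemma AE_chi_eq_cf: "cmod (cf \<mu> s n) = 1 \<Longrightarrow> AE p in \<mu>. cval (chi s n p) = cf \<mu> s n"
  unfolding cf_eq by (intro norm_one_integral_AE) (auto simp del: cval_chi intro: prob_space_axioms)

text \<open>A character at which the characteristic function has modulus one is almost everywhere
  constant, so it can be pulled out of the integral.\<close>

lemma cf_add_of_norm_one:
  assumes "cmod (cf \<mu> s m) = 1"
  shows "cf \<mu> (s + t) (m + n) = cf \<mu> s m * cf \<mu> t n"
proof -
  have "(LINT p|\<mu>. cval (chi (s + t) (m + n) p)) = (LINT p|\<mu>. cf \<mu> s m * cval (chi t n p))"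
    using AE_chi_eq_cf[OF assms]
    by (intro integral_cong_AE) (auto simp: chi_add simp del: cval_chi elim!: eventually_mono)
  then show ?thesis
    by (simp add: cf_eq)
qed

end

subsection \<open>Gaussian distributions on a helix\<close>

lemma openin_character_topology:
  assumes "compact K" "open U"
  shows "openin character_topology {y \<in> characters. y ` K \<subseteq> U}"
proof -
  have "openin compact_open_topology {f. continuous_on UNIV f \<and> f ` K \<subseteq> U}"
    unfolding compact_open_topology_def openin_topology_generated_by_iff
    using assms by (intro generate_topology_on.Basis) blast
  moreover have "{y \<in> characters. y ` K \<subseteq> U} = {f. continuous_on UNIV f \<and> f ` K \<subseteq> U} \<inter> characters"
    by (auto simp: characters_def)
  ultimately show ?thesis
    unfolding character_topology_def openin_subtopology by blast
qed

text \<open>The graph of the homomorphism \<open>t\<close> to \<open>cis (c * t)\<close>. As a graph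
  it is closed and is mapped homeomorphically onto the line by \<open>fst\<close>, which a general
  one-parameter subgroup need not be.\<close>

definition helix :: "real \<Rightarrow> real \<Rightarrow> real \<times> circle" where
  "helix c t = (t, Abs_circle (cis (c * t)))"

lemma fst_helix [simp]: "fst (helix c t) = t"
  by (simp add: helix_def)

lemma helix_add: "helix c (s + t) = helix c s + helix c t"
  by (simp add: helix_def distrib_left Abs_circle_cis_add)

lemma continuous_on_helix: "continuous_on UNIV (helix c)"
  unfolding helix_def
  by (intro continuous_intros continuous_on_compose2[OF continuous_on_Abs_circle_cis]) auto

lemma cval_chi_helix: "cval (chi s n (helix c t)) = cis ((s + c * of_int n) * t)"
  by (simp add: helix_def cis_power_int cis_mult algebra_simps)

lemma add_subgroup_helix: "add_subgroup (range (helix c))"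
proof -
  have "helix c 0 = 0"
    using helix_add[of c 0 0] by simp
  moreover have "- helix c t = helix c (- t)" for t
    using helix_add[of c t "- t"] \<open>helix c 0 = 0\<close> by (simp add: minus_unique)
  ultimately show ?thesis
    unfolding add_subgroup_def by (auto simp flip: helix_add intro: rev_image_eqI[of 0])
qed

lemma topologically_isomorphic_helix:
  "topologically_isomorphic (range (helix c)) (UNIV :: real set)"
  unfolding topologically_isomorphic_def
proof (intro exI conjI)
  show "homeomorphism (range (helix c)) UNIV fst (helix c)"
    unfolding homeomorphism_def
    by (auto simp: image_image continuous_on_helix intro!: continuous_intros)
qed auto

text \<open>On the set of characters \<open>y\<close> with \<open>Re y > 0\<close> along an initial piece of the helix the frequency
  of \<open>y\<close> along the helix is recovered from a single value of \<open>y\<close> by \<open>arcsin\<close>.\<close>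

lemma continuous_map_frequency_square:
  assumes \<phi>: "\<And>s n. \<phi> (chi s n) = \<sigma> * (s + c * of_int n)\<^sup>2"
  shows "continuous_map character_topology euclideanreal \<phi>"
  unfolding continuous_map topspace_character_topology topspace_euclidean
proof (intro conjI allI impI)
  fix V :: "real set" assume "openin euclidean V"
  then have V: "open V" by simp
  show "openin character_topology {y \<in> characters. \<phi> y \<in> V}"
  proof (subst openin_subopen, intro ballI)
    fix y0 assume y0: "y0 \<in> {y \<in> characters. \<phi> y \<in> V}"
    then obtain s0 n0 where y0_eq: "y0 = chi s0 n0"
      by (blast elim: characters_cases)
    define q0 where "q0 = s0 + c * of_int n0"
    \<comment> \<open>Short enough that \<open>\<bar>q0\<bar> * T < 1 < pi / 2\<close>, so
      \<open>y0\<close> itself lies in \<open>W\<close>.\<close>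
    define T where "T = 1 / (\<bar>q0\<bar> + 1)"
    have T: "T > 0" "\<bar>q0\<bar> * T < 1"
      by (auto simp: T_def field_simps)
    define W where "W = {y \<in> characters. y ` (helix c ` {0..T}) \<subseteq> {z. Re (cval z) > 0}}"
    define h where "h z = \<sigma> * (arcsin (Im (cval z)) / T)\<^sup>2" for z
    have Im: "\<bar>Im (cval z)\<bar> \<le> 1" for z
      using abs_Im_le_cmod[of "cval z"] by simp
    have h: "continuous_on UNIV h"
      unfolding h_def using T Im
      by (intro continuous_intros continuous_on_cval) (auto simp: abs_le_iff minus_le_iff)
    have \<phi>_eq: "\<phi> y = h (y (helix c T))" if y: "y \<in> W" for y
    proof -
      from y obtain s n where y_eq: "y = chi s n"
        by (auto simp: W_def elim: characters_cases)
      define q where "q = s + c * of_int n"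
      have pos: "cos (q * t) > 0" if "t \<in> {0..T}" for t
      proof -
        have "0 < Re (cval (chi s n (helix c t)))"
          using y that unfolding W_def y_eq by blast
        then show ?thesis
          by (simp only: cval_chi_helix q_def cis.sel)
      qed
      have "\<bar>q\<bar> * T < pi / 2"
      proof (rule ccontr)
        assume "\<not> ?thesis"
        then have le: "pi / 2 \<le> \<bar>q\<bar> * T" by simp
        then have "q \<noteq> 0" using pi_half_gt_zero by (metis abs_zero mult_zero_left not_le)
        \<comment> \<open>The first zero of the cosine of \<open>q * t\<close> would fall within the
          piece of the helix on which the real part is positive.\<close>
        then have "pi / (2 * \<bar>q\<bar>) \<in> {0..T}"
          using le by (auto simp: field_simps)
        from pos[OF this] have "cos (q * (pi / (2 * \<bar>q\<bar>))) > 0" .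
        also have "q * (pi / (2 * \<bar>q\<bar>)) = pi / 2 \<or> q * (pi / (2 * \<bar>q\<bar>)) = - (pi / 2)"
          using \<open>q \<noteq> 0\<close> by (auto simp: abs_if)
        then have "cos (q * (pi / (2 * \<bar>q\<bar>))) = 0"
          by (elim disjE) (simp_all only: cos_minus cos_pi_half)
        finally show False by simp
      qed
      then have "\<bar>q * T\<bar> < pi / 2"
        using T by (simp add: abs_mult)
      then have "arcsin (sin (q * T)) = q * T"
        by (intro arcsin_sin) auto
      then show ?thesis
        using T by (simp add: h_def y_eq \<phi> cval_chi_helix flip: q_def del: cval_chi)
    qed
    have W: "openin character_topology W"
      unfolding W_def
    proof (rule openin_character_topology)
      show "compact (helix c ` {0..T})"
        by (intro compact_continuous_image continuous_on_subset[OF continuous_on_helix]) auto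
      show "open {z. Re (cval z) > 0}"
        by (intro open_Collect_less continuous_intros continuous_on_cval)
    qed
    have "y0 \<in> W"
    proof -
      have "cos (q0 * t) > 0" if "t \<in> {0..T}" for t
      proof -
        have "\<bar>q0 * t\<bar> \<le> \<bar>q0\<bar> * T"
          using that by (simp add: abs_mult mult_left_mono)
        then have "\<bar>q0 * t\<bar> < pi / 2"
          using T pi_gt3 by linarith
        then show ?thesis
          by (intro cos_gt_zero_pi) auto
      qed
      then show ?thesis
        using y0 by (auto simp: W_def y0_eq cval_chi_helix q0_def simp del: cval_chi)
    qed
    have "open (h -` V)"
      using continuous_on_open_vimage[of UNIV h] h V by auto
    then have "openin character_topology (W \<inter> {y \<in> characters. y ` {helix c T} \<subseteq> h -` V})"
      by (intro openin_Int W openin_character_topology) simp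
    moreover have "y0 \<in> W \<inter> {y \<in> characters. y ` {helix c T} \<subseteq> h -` V}"
      using y0 \<open>y0 \<in> W\<close> \<phi>_eq by auto
    moreover have "W \<inter> {y \<in> characters. y ` {helix c T} \<subseteq> h -` V} \<subseteq> {y \<in> characters. \<phi> y \<in> V}"
      using \<phi>_eq by auto
    ultimately show "\<exists>S. openin character_topology S \<and> y0 \<in> S \<and> S \<subseteq> {y \<in> characters. \<phi> y \<in> V}"
      by blast
  qed
qed auto

text \<open>The density is positive everywhere, so a null set of the normal law is Lebesgue null,
  which no nonempty open set is.\<close>

lemma emeasure_std_normal_open_pos:
  assumes V: "open V" "x \<in> V"
  shows "emeasure std_normal_distribution V > 0"
proof (rule ccontr)
  assume "\<not> ?thesis"
  then have "V \<in> null_sets (density lborel std_normal_density)"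
    using V by (auto intro!: null_setsI)
  moreover have "\<not> std_normal_density x \<le> 0" for x
    by (simp add: not_le normal_density_pos)
  ultimately have "AE x in lborel. x \<notin> V"
    by (subst (asm) null_sets_density_iff) (auto simp: ennreal_eq_0_iff)
  then have null: "emeasure lborel V = 0"
    using V by (subst (asm) AE_iff_measurable[of V]) auto
  obtain e where e: "e > 0" "ball x e \<subseteq> V"
    using V by (auto simp: open_contains_ball)
  have "emeasure lborel {x - e<..<x + e} \<le> emeasure lborel V"
    using e V by (intro emeasure_mono) (auto simp: ball_eq_greaterThanLessThan)
  then show False
    using null e by simp
qed

lemma char_affine_std_normal:
  "char (distr std_normal_distribution borel (\<lambda>x. \<beta> + \<tau> * x)) s =
     cis (\<beta> * s) * of_real (exp (- ((\<tau> * s)\<^sup>2 / 2)))"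
proof -
  have "char (distr std_normal_distribution borel (\<lambda>x. \<beta> + \<tau> * x)) s =
      (CLINT x|std_normal_distribution. iexp (s * (\<beta> + \<tau> * x)))"
    unfolding char_def by (subst integral_distr) auto
  also have "\<dots> = (CLINT x|std_normal_distribution. cis (\<beta> * s) * iexp ((\<tau> * s) * x))"
    by (simp add: cis_conv_exp exp_add[symmetric] algebra_simps)
  also have "\<dots> = cis (\<beta> * s) * char std_normal_distribution (\<tau> * s)"
    by (simp add: char_def)
  finally show ?thesis
    by (simp add: char_std_normal_distribution)
qed

section \<open>Distributions concentrated on a coset of a helix\<close>

context real_circle_distribution
begin

context
  fixes \<sigma> \<beta> c :: real
  assumes gauss: "\<And>s. cf \<mu> s 0 = of_real (exp (- (\<sigma> * s\<^sup>2))) * cis (\<beta> * s)"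
    and nonneg: "\<sigma> \<ge> 0"
    and norm_one: "cmod (cf \<mu> (- c) 1) = 1"
begin

definition shift :: "real \<times> circle" where
  "shift = (0, Abs_circle (cf \<mu> (- c) 1))"

text \<open>The character with frequencies \<open>(- c, 1)\<close> has the helix as its kernel. By
  \<open>norm_one\<close> it is almost everywhere equal to its mean, which is the circle coordinate
  of \<open>shift\<close>.\<close>

lemma AE_helix: "AE p in \<mu>. p = shift + helix c (fst p)"
  using AE_chi_eq_cf[OF norm_one]
proof eventually_elim
  case (elim p)
  have "cval (snd p) = cis (c * fst p) * (cis (- c * fst p) * cval (snd p))"
    by (simp add: cis_mult flip: mult.assoc)
  also have "cis (- c * fst p) * cval (snd p) = cf \<mu> (- c) 1"
    using elim by simp
  finally show ?case
    using norm_one by (intro prod_eqI circle_eqI) (simp_all add: shift_def helix_def)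
qed

text \<open>Along the helix the frequencies \<open>(s, n)\<close> and
  \<open>(s + c * of_int n, 0)\<close> give the same character, so the values on the real line
  determine the whole characteristic function.\<close>

lemma cf_helix: "cf \<mu> s n = cval (chi s n shift) * cf \<mu> (s + c * of_int n) 0"
proof -
  have "(LINT p|\<mu>. cval (chi s n p)) =
      (LINT p|\<mu>. cval (chi s n shift) * cval (chi (s + c * of_int n) 0 p))"
  proof (intro integral_cong_AE)
    show "AE p in \<mu>. cval (chi s n p) = cval (chi s n shift) * cval (chi (s + c * of_int n) 0 p)"
      using AE_helix
    proof eventually_elim
      case (elim p)
      have "cval (chi s n p) = cval (chi s n (shift + helix c (fst p)))"
        using elim by simp
      also have "\<dots> = cval (chi s n shift) * cval (chi s n (helix c (fst p)))"
        by (rule additive_cval) (use chi_in_characters in \<open>simp add: characters_def\<close>)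
      also have "cval (chi s n (helix c (fst p))) = cval (chi (s + c * of_int n) 0 p)"
        by (simp only: cval_chi_helix) simp
      finally show ?case .
    qed
  qed (auto simp del: cval_chi)
  then show ?thesis
    by (simp add: cf_eq del: cval_chi)
qed

lemma measurable_shift_helix: "(\<lambda>t. shift + helix c (\<beta> + \<tau> * t)) \<in> borel_measurable borel"
  by (intro borel_measurable_continuous_onI continuous_intros
      continuous_on_compose2[OF continuous_on_helix]) auto

text \<open>Almost every point is determined by its first coordinate, whose law is identified by
  Levy's uniqueness theorem. The scale is \<open>sqrt (2 * \<sigma>)\<close> because scale \<tau>
  contributes \<open>(\<tau> * s)\<^sup>2 / 2\<close> to the exponent.\<close>

lemma distr_helix:
  "\<mu> = distr std_normal_distribution borel (\<lambda>t. shift + helix c (\<beta> + sqrt (2 * \<sigma>) * t))"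
proof -
  have fst: "fst \<in> borel_measurable \<mu>"
    unfolding measurable_cong_sets[OF sets_eq refl]
    by (intro borel_measurable_continuous_onI continuous_intros)
  let ?N = "distr std_normal_distribution borel (\<lambda>t. \<beta> + sqrt (2 * \<sigma>) * t)"
  have helix: "(\<lambda>t. shift + helix c t) \<in> borel_measurable borel"
    using measurable_shift_helix[of 1] borel_measurable_continuous_onI[of "\<lambda>t. shift + helix c t"]
    by (simp add: continuous_on_add continuous_on_helix)
  have "distr \<mu> borel fst = ?N"
  proof (rule Levy_uniqueness)
    show "real_distribution (distr \<mu> borel fst)"
      using fst by (intro prob_space.real_distribution_distr) (auto intro: prob_space_axioms)
    show "real_distribution ?N"
      by (intro prob_space.real_distribution_distr) (auto intro: prob_space_normal_density)
    show "char (distr \<mu> borel fst) = char ?N"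
    proof
      fix s
      have "char (distr \<mu> borel fst) s = (CLINT p|\<mu>. iexp (s * fst p))"
        unfolding char_def using fst by (subst integral_distr) auto
      also have "\<dots> = cf \<mu> s 0"
        by (simp add: cf_eq cis_conv_exp)
      finally show "char (distr \<mu> borel fst) s = char ?N s"
        using nonneg by (simp add: gauss char_affine_std_normal power_mult_distrib)
    qed
  qed
  have "\<mu> = distr \<mu> borel (\<lambda>p. p)"
    by (simp add: distr_id2)
  also have "\<dots> = distr \<mu> borel (\<lambda>p. shift + helix c (fst p))"
    using AE_helix fst by (intro distr_cong_AE) (auto intro: measurable_compose[OF _ helix])
  also have "\<dots> = distr (distr \<mu> borel fst) borel (\<lambda>t. shift + helix c t)"
    using fst by (subst distr_distr[OF helix]) (auto simp: o_def)
  also have "\<dots> = distr ?N borel (\<lambda>t. shift + helix c t)"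
    using \<open>distr \<mu> borel fst = ?N\<close> by simp
  also have "\<dots> = distr std_normal_distribution borel (\<lambda>t. shift + helix c (\<beta> + sqrt (2 * \<sigma>) * t))"
    by (subst distr_distr[OF helix]) (auto simp: o_def)
  finally show ?thesis .
qed

lemma emeasure_helix:
  assumes "A \<in> sets borel"
  shows "emeasure \<mu> A =
    emeasure std_normal_distribution ((\<lambda>t. shift + helix c (\<beta> + sqrt (2 * \<sigma>) * t)) -` A)"
  using assms measurable_shift_helix[of "sqrt (2 * \<sigma>)"]
  by (subst distr_helix) (simp add: emeasure_distr)

lemma degenerate_if_zero_variance:
  assumes "\<sigma> = 0"
  shows "degenerate \<mu>"
proof -
  interpret N: prob_space std_normal_distribution
    by (rule prob_space_normal_density) simp
  have "emeasure \<mu> {shift + helix c \<beta>} = 1"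
    using N.emeasure_space_1 by (subst emeasure_helix) (simp_all add: assms vimage_def)
  then show ?thesis
    unfolding degenerate_def by (intro exI[of _ "shift + helix c \<beta>"]) (simp add: measure_def)
qed

text \<open>The exponent is read off as minus the logarithm of the modulus; by
  \<open>cf_helix\<close> it is the square of a linear form in the frequencies, up to the factor
  \<sigma>, and so satisfies the parallelogram identity.\<close>

lemma gaussian_helix: "gaussian \<mu>"
  unfolding gaussian_def
proof (intro exI conjI ballI)
  let ?\<phi> = "\<lambda>y. - ln (cmod (char_function \<mu> y))"
  have \<phi>: "?\<phi> (chi s n) = \<sigma> * (s + c * of_int n)\<^sup>2" for s n
    using cf_helix[of s n] by (simp add: cf_def[symmetric] norm_mult gauss del: cval_chi)
  show "continuous_map character_topology euclideanreal ?\<phi>"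
    by (rule continuous_map_frequency_square[OF \<phi>])
  show "0 \<le> ?\<phi> y" if "y \<in> characters" for y
  proof -
    obtain s n where "y = chi s n" using \<open>y \<in> characters\<close> by (rule characters_cases)
    then show ?thesis
      using nonneg by (simp only: \<phi>) simp
  qed
  show "?\<phi> (\<lambda>t. u t + v t) + ?\<phi> (\<lambda>t. u t - v t) = 2 * (?\<phi> u + ?\<phi> v)"
    if "u \<in> characters" "v \<in> characters" for u v
  proof -
    obtain s m where u: "u = chi s m" using \<open>u \<in> characters\<close> by (rule characters_cases)
    obtain t n where v: "v = chi t n" using \<open>v \<in> characters\<close> by (rule characters_cases)
    have "?\<phi> (chi (s + t) (m + n)) + ?\<phi> (chi (s - t) (m - n)) = 2 * (?\<phi> u + ?\<phi> v)"
      unfolding \<phi> u v by (simp add: power2_eq_square algebra_simps)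
    moreover have "(\<lambda>t. u t + v t) = chi (s + t) (m + n)" "(\<lambda>t. u t - v t) = chi (s - t) (m - n)"
      by (simp_all add: u v chi_add chi_minus fun_eq_iff)
    ultimately show ?thesis
      by (simp only:)
  qed
  show "char_function \<mu> y = cval (y (shift + helix c \<beta>)) * complex_of_real (exp (- ?\<phi> y))"
    if "y \<in> characters" for y
  proof -
    obtain s n where y: "y = chi s n" using \<open>y \<in> characters\<close> by (rule characters_cases)
    have "cval (y (shift + helix c \<beta>)) = cval (chi s n shift) * cval (chi s n (helix c \<beta>))"
      unfolding y by (rule additive_cval) (use chi_in_characters in \<open>simp add: characters_def\<close>)
    then have 1: "cval (y (shift + helix c \<beta>)) = cval (chi s n shift) * cis ((s + c * of_int n) * \<beta>)"
      by (simp only: cval_chi_helix)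
    have 2: "?\<phi> y = \<sigma> * (s + c * of_int n)\<^sup>2"
      unfolding y by (rule \<phi>)
    have 3: "char_function \<mu> y = cval (chi s n shift) *
        (of_real (exp (- (\<sigma> * (s + c * of_int n)\<^sup>2))) * cis (\<beta> * (s + c * of_int n)))"
      unfolding y cf_def[symmetric] cf_helix[of s n] gauss ..
    show ?thesis
      unfolding 2 unfolding 1 3 by (simp only: mult_ac)
  qed
qed

text \<open>The coset is closed and has full measure, which bounds the support from above.
  Conversely, since \<sigma> is positive the parametrisation reaches the whole coset, and open sets
  meeting it pull back to nonempty open sets of the line.\<close>

lemma support_helix:
  assumes "\<sigma> > 0"
  shows "measure_support \<mu> = (\<lambda>g. shift + g) ` range (helix c)"
proof (intro set_eqI iffI)
  fix p assume p: "p \<in> measure_support \<mu>"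
  show "p \<in> (\<lambda>g. shift + g) ` range (helix c)"
  proof (rule ccontr)
    assume "p \<notin> (\<lambda>g. shift + g) ` range (helix c)"
    then have "p \<noteq> shift + helix c (fst p)"
      by blast
    moreover have "open {p. p \<noteq> shift + helix c (fst p)}"
      by (intro open_Collect_neq continuous_intros continuous_on_compose2[OF continuous_on_helix]) auto
    ultimately have "emeasure \<mu> {p. p \<noteq> shift + helix c (fst p)} > 0"
      using p by (auto simp: measure_support_def)
    moreover have "emeasure \<mu> {p. p \<noteq> shift + helix c (fst p)} = 0"
      using AE_helix \<open>open _\<close>
      by (subst (asm) AE_iff_measurable[OF _ refl]) (auto simp: sets_eq_imp_space_eq[OF sets_eq])
    ultimately show False by simp
  qed
next
  fix p assume "p \<in> (\<lambda>g. shift + g) ` range (helix c)"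
  then obtain t where t: "p = shift + helix c t" by blast
  show "p \<in> measure_support \<mu>"
    unfolding measure_support_def
  proof (intro CollectI allI impI)
    fix U assume U: "open U \<and> p \<in> U"
    let ?g = "\<lambda>t. shift + helix c (\<beta> + sqrt (2 * \<sigma>) * t)"
    have "continuous_on UNIV ?g"
      by (intro continuous_intros continuous_on_compose2[OF continuous_on_helix]) auto
    then have "open (?g -` U)"
      using continuous_on_open_vimage[of UNIV ?g] U by auto
    moreover have "(t - \<beta>) / sqrt (2 * \<sigma>) \<in> ?g -` U"
      using U t assms by simp
    ultimately have "emeasure std_normal_distribution (?g -` U) > 0"
      by (rule emeasure_std_normal_open_pos)
    then show "emeasure \<mu> U > 0"
      using U by (subst emeasure_helix) auto
  qed
qed

lemma degenerate_or_gaussian_helix: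
  "degenerate \<mu> \<or> (gaussian \<mu> \<and>
    (\<exists>G. add_subgroup G \<and> topologically_isomorphic G (UNIV :: real set) \<and>
         is_coset_of (measure_support \<mu>) G))"
proof (cases "\<sigma> = 0")
  case False
  then have "measure_support \<mu> = (\<lambda>g. shift + g) ` range (helix c)"
    using nonneg support_helix by simp
  then have "is_coset_of (measure_support \<mu>) (range (helix c))"
    unfolding is_coset_of_def by (rule exI)
  then show ?thesis
    using gaussian_helix add_subgroup_helix topologically_isomorphic_helix by blast
qed (use degenerate_if_zero_variance in simp)

end

end

subsection \<open>The functional equation\<close>

text \<open>The properties of a characteristic function that enter the functional equation, detached
  from the measure.\<close>

locale nonvanishing_cf =
  fixes \<phi> :: "real \<Rightarrow> int \<Rightarrow> complex"
  assumes at_0 [simp]: "\<phi> 0 0 = 1"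
    and nonzero [simp]: "\<phi> s n \<noteq> 0"
    and norm_le: "cmod (\<phi> s n) \<le> 1"
    and minus: "\<phi> (- s) (- n) = cnj (\<phi> s n)"
    and cont: "continuous_on UNIV (\<lambda>s. \<phi> s n)"
    and add_of_norm_one: "cmod (\<phi> s m) = 1 \<Longrightarrow> \<phi> (s + t) (m + n) = \<phi> s m * \<phi> t n"
begin

lemma continuous_on_phi [continuous_intros]:
  "continuous_on S f \<Longrightarrow> continuous_on S (\<lambda>x. \<phi> (f x) n)"
  using continuous_on_compose2[OF cont] by blast

lemma norm_minus: "cmod (\<phi> (- s) (- n)) = cmod (\<phi> s n)"
  by (simp add: minus)

lemma degenerate_real_part:
  assumes "\<And>s. cmod (\<phi> s 0) = 1"
  obtains \<beta> where "\<And>s. \<phi> s 0 = cis (\<beta> * s)"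
proof (rule continuous_hom_real_circle[of "\<lambda>s. \<phi> s 0"])
  show "\<phi> (s + t) 0 = \<phi> s 0 * \<phi> t 0" for s t
    using add_of_norm_one[OF assms, of s t 0] by simp
qed (use cont assms that in auto)

lemma degenerate_real_part_norm:
  assumes "\<And>s. cmod (\<phi> s 0) = 1"
  shows "n \<in> {1, - 1} \<Longrightarrow> cmod (\<phi> s n) = cmod (\<phi> 0 1)"
  using add_of_norm_one[OF assms, of s 0 n] norm_minus[of 0 1] by (auto simp: norm_mult assms)

text \<open>The equation says that \<open>\<phi> (x + t) / (\<phi> x * \<phi> t)\<close>, for \<open>t\<close> real, is multiplicative in \<open>x\<close>. On the
  real line it is symmetric in \<open>x\<close> and \<open>t\<close>, so there \<open>ln \<bar>\<phi>\<bar>\<close> is a quadratic form, and the phase, being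
  odd, is a character.\<close>

context
  assumes quad: "\<And>x y t m n. \<phi> (x + y + t) (m + n) * \<phi> t 0 * \<phi> x m * \<phi> y n =
    \<phi> (x + t) m * \<phi> (y + t) n * \<phi> (x + y) (m + n)"
begin

lemma quadratic_norm:
  obtains \<sigma> where "\<sigma> \<ge> 0" "\<And>s. cmod (\<phi> s 0) = exp (- (\<sigma> * s\<^sup>2))"
proof -
  define f where "f s = ln (cmod (\<phi> s 0))" for s
  define b where "b x y = f (x + y) - f x - f y" for x y
  have quad_f: "f (x + y + t) + f t + f x + f y = f (x + t) + f (y + t) + f (x + y)" for x y t
    using arg_cong[OF quad[of x y t 0 0], of "\<lambda>z. ln (cmod z)"]
    by (simp add: f_def norm_mult ln_mult)
  have "b (x + y) z = b x z + b y z" for x y z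
    using quad_f[of x y z] by (simp add: b_def)
  moreover have "b x y = b y x" for x y
    by (simp add: b_def add.commute)
  moreover have "continuous_on UNIV (\<lambda>x. b x z)" "continuous_on UNIV (b z)" for z
    unfolding b_def[abs_def] f_def by (auto intro!: continuous_intros)
  ultimately have b: "b x y = x * y * b 1 1" for x y
    by (intro continuous_biadditive_real) auto
  have f: "f s = s\<^sup>2 * b 1 1 / 2" for s
  proof -
    have "f 0 = 0" "f (- s) = f s"
      using norm_minus[of s 0] by (simp_all add: f_def)
    \<comment> \<open>Evenness of \<open>f\<close> recovers the quadratic form from its polarisation
      \<open>b\<close>.\<close>
    then have "b s (- s) = - 2 * f s"
      by (simp add: b_def)
    then show ?thesis
      using b[of s "- s"] by (simp add: power2_eq_square)
  qed
  have "f 1 \<le> 0"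
    using norm_le[of 1 0] by (simp add: f_def)
  moreover have "cmod (\<phi> s 0) = exp (f s)" for s
    by (simp add: f_def)
  ultimately show thesis
    using that[of "- b 1 1 / 2"] by (simp add: f mult.commute)
qed

lemma quadratic_phase:
  obtains \<beta> where "\<And>s. sgn (\<phi> s 0) = cis (\<beta> * s)"
proof (rule continuous_hom_real_circle[of "\<lambda>s. sgn (\<phi> s 0)"])
  define h where "h s = sgn (\<phi> s 0)" for s
  have h_nz: "h s \<noteq> 0" and h_0: "h 0 = 1" and h_norm: "cmod (h s) = 1" for s
    by (simp_all add: h_def sgn_zero_iff norm_sgn)
  define b where "b x y = h (x + y) / (h x * h y)" for x y
  have quad_h: "h (x + y + t) * h t * h x * h y = h (x + t) * h (y + t) * h (x + y)" for x y t
    using arg_cong[OF quad[of x y t 0 0], of sgn] by (simp add: h_def sgn_mult)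
  have bilin: "b (x + y) z = b x z * b y z" for x y z
    using quad_h[of x y z] by (simp add: b_def h_nz field_simps)
  have sym: "b x y = b y x" for x y
    by (simp add: b_def add.commute mult.commute)
  have h_minus: "h (- s) = inverse (h s)" for s
  proof -
    have "h (- s) = cnj (h s)"
      using minus[of s 0] by (simp add: h_def sgn_div_norm)
    moreover have "h s * cnj (h s) = 1"
      using complex_norm_square[of "h s"] h_norm[of s] by simp
    ultimately show ?thesis
      by (simp add: inverse_unique)
  qed
  have b_inv: "b (- x) (- y) = inverse (b x y)" for x y
    using h_minus[of "x + y"] by (simp add: b_def h_minus field_simps)
  have b_0: "b 0 y = 1" for y
    by (simp add: b_def h_0 h_nz)
  have b_neg: "b (- x) y = inverse (b x y)" for x y
    using bilin[of x "- x" y] b_0[of y] by (simp add: inverse_unique)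
  \<comment> \<open>Changing both signs inverts \<open>b\<close> because the phase is odd, yet
    leaves it unchanged because \<open>b\<close> is multiplicative in each argument.\<close>
  have sq: "b x y * b x y = 1" for x y
  proof -
    have "inverse (b x y) = b (- x) (- y)"
      by (simp add: b_inv)
    also have "\<dots> = b x y"
      by (simp add: b_neg sym[of x "- y"] sym[of y x])
    finally show ?thesis
      by (metis b_def divide_eq_0_iff h_nz mult_eq_0_iff right_inverse)
  qed
  \<comment> \<open>By halving, every value of \<open>b\<close> is the square of another
    value.\<close>
  have "b x y = 1" for x y
    using bilin[of "x / 2" "x / 2" y] sq[of "x / 2" y] by simp
  then show "sgn (\<phi> (x + y) 0) = sgn (\<phi> x 0) * sgn (\<phi> y 0)" for x y
    by (simp add: b_def h_nz h_def[symmetric])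
  show "continuous_on UNIV (\<lambda>s. sgn (\<phi> s 0))"
    by (intro continuous_intros) auto
qed (use that in \<open>auto simp: norm_sgn\<close>)

lemma quadratic_real_part:
  obtains \<sigma> \<beta> where "\<sigma> \<ge> 0" "\<And>s. \<phi> s 0 = of_real (exp (- (\<sigma> * s\<^sup>2))) * cis (\<beta> * s)"
proof -
  obtain \<sigma> where \<sigma>: "\<sigma> \<ge> 0" "\<And>s. cmod (\<phi> s 0) = exp (- (\<sigma> * s\<^sup>2))"
    using quadratic_norm by blast
  obtain \<beta> where \<beta>: "\<And>s. sgn (\<phi> s 0) = cis (\<beta> * s)"
    using quadratic_phase by blast
  have "\<phi> s 0 = of_real (cmod (\<phi> s 0)) * sgn (\<phi> s 0)" for s
    by (simp add: sgn_eq)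
  then show thesis
    using that[OF \<sigma>(1)] \<beta> \<sigma>(2) by metis
qed

lemma quadratic_norm_maximum:
  assumes \<sigma>: "\<sigma> > 0" "\<And>s. cmod (\<phi> s 0) = exp (- (\<sigma> * s\<^sup>2))"
  obtains c where "\<And>s n. n \<in> {1, - 1} \<Longrightarrow> cmod (\<phi> s n) \<le> cmod (\<phi> (- c) 1)"
    "\<And>n. n \<in> {1, - 1} \<Longrightarrow> cmod (\<phi> (- (c * of_int n)) n) = cmod (\<phi> (- c) 1)"
proof -
  define f where "f s = ln (cmod (\<phi> s 1))" for s
  \<comment> \<open>\<open>k\<close> is what remains of \<open>f\<close> after removing its constant
    and quadratic parts; it is additive, so \<open>f\<close> is a downward parabola. The choice of
    \<open>c\<close> below puts its vertex at \<open>- c\<close>.\<close>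
  define k where "k s = f s - f 0 + \<sigma> * s\<^sup>2" for s
  have "k (s + t) = k s + k t" for s t
    using arg_cong[OF quad[of s 0 t 0 1], of "\<lambda>z. ln (cmod z)"]
    by (simp add: k_def f_def norm_mult ln_mult \<sigma> power2_eq_square algebra_simps)
  moreover have "continuous_on UNIV k"
    unfolding k_def f_def by (intro continuous_intros) auto
  ultimately have k: "k s = s * k 1" for s
    by (rule additive_continuous_real_linear)
  define c where "c = - k 1 / (2 * \<sigma>)"
  have "k 1 = - 2 * \<sigma> * c"
    using \<sigma>(1) by (simp add: c_def)
  then have f: "f s = f 0 + \<sigma> * c\<^sup>2 - \<sigma> * (s + c)\<^sup>2" for s
    using k[of s] by (simp add: k_def[of s] power2_eq_square algebra_simps)
  have "f s \<le> f (- c)" for s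
    using \<sigma>(1) by (simp add: f[of s] f[of "- c"])
  then have le: "cmod (\<phi> s 1) \<le> cmod (\<phi> (- c) 1)" for s
    by (simp add: f_def)
  have "cmod (\<phi> s (- 1)) = cmod (\<phi> (- s) 1)" for s
    using norm_minus[of "- s" 1] by simp
  with le show thesis
    by (intro that[of c]) auto
qed

end

end

section \<open>Products, matrices and signs for three forms\<close>

lemma prod_le_one_eq_one:
  fixes f :: "'a \<Rightarrow> real"
  assumes "finite A" "\<And>x. x \<in> A \<Longrightarrow> 0 \<le> f x" "\<And>x. x \<in> A \<Longrightarrow> f x \<le> 1"
    and "prod f A = 1" "x \<in> A"
  shows "f x = 1"
proof -
  have "prod f A = f x * prod f (A - {x})"
    using assms by (simp add: prod.remove)
  also have "\<dots> \<le> f x * 1"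
    using assms by (intro mult_left_mono prod_le_1) auto
  finally show ?thesis
    using assms by (intro antisym) auto
qed

lemma sum_1_3: "sum f {1..3::nat} = f 1 + f 2 + f 3"
  by (simp add: numeral_3_eq_3 numeral_2_eq_2)

lemma prod_1_3: "prod f {1..3::nat} = f 1 * f 2 * f 3"
  by (simp add: numeral_3_eq_3 numeral_2_eq_2)

text \<open>The alternative is between a direction of real arguments that changes no factor on the
  left of the functional equation and, for each \<open>k\<close>, one that changes only the
  \<open>k\<close>-th. The rows of \<open>A\<close> are the columns of \<open>a\<close>; the second
  case applies the inverse of \<open>A\<close> to unit vectors.\<close>

lemma singular_or_invertible_3:
  fixes a :: "nat \<Rightarrow> nat \<Rightarrow> real"
  obtains d i where "i \<in> {1..3}" "d i \<noteq> 0" "\<And>j. j \<in> {1..3} \<Longrightarrow> (\<Sum>i=1..3. a i j * d i) = 0"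
  | "\<And>k. k \<in> {1..3} \<Longrightarrow>
      \<exists>d. \<forall>j\<in>{1..3}. (\<Sum>i=1..3. a i j * d i) = (if j = k then 1 else 0)"
proof -
  define A :: "real^3^3" where
    "A = vector [vector [a 1 1, a 2 1, a 3 1], vector [a 1 2, a 2 2, a 3 2], vector [a 1 3, a 2 3, a 3 3]]"
  have A: "(\<Sum>i=1..3. a i 1 * (if i = 1 then x $ 1 else if i = 2 then x $ 2 else x $ 3)) = (A *v x) $ 1"
    "(\<Sum>i=1..3. a i 2 * (if i = 1 then x $ 1 else if i = 2 then x $ 2 else x $ 3)) = (A *v x) $ 2"
    "(\<Sum>i=1..3. a i 3 * (if i = 1 then x $ 1 else if i = 2 then x $ 2 else x $ 3)) = (A *v x) $ 3"
    for x :: "real^3"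
    unfolding sum_1_3 by (simp_all add: A_def matrix_vector_mult_def sum_3)
  have cases_3: "j \<in> {1..3} \<longleftrightarrow> j = 1 \<or> j = 2 \<or> j = 3" for j :: nat
    by auto
  show thesis
  proof (cases "\<exists>x. A *v x = 0 \<and> x \<noteq> 0")
    case True
    then obtain x where x: "A *v x = 0" "x \<noteq> 0" by blast
    define d where "d i = (if i = 1 then x $ 1 else if i = 2 then x $ 2 else x $ 3)" for i :: nat
    have "d 1 \<noteq> 0 \<or> d 2 \<noteq> 0 \<or> d 3 \<noteq> 0"
      using x(2) by (auto simp: d_def vec_eq_iff forall_3)
    moreover have "(\<Sum>i=1..3. a i j * d i) = 0" if "j \<in> {1..3}" for j
      using that A[of x] x(1) unfolding d_def cases_3 by auto
    ultimately show thesis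
      using that(1)[of _ d] unfolding cases_3 by blast
  next
    case False
    then obtain B where "B ** A = mat 1"
      using matrix_left_invertible_ker[of A] by blast
    then have B: "A ** B = mat 1"
      by (simp add: matrix_left_right_inverse)
    have "\<exists>d. \<forall>j\<in>{1..3}. (\<Sum>i=1..3. a i j * d i) = (if j = k then 1 else 0)"
      if "k \<in> {1..3}" for k
    proof -
      define v :: "real^3" where
        "v = vector [if k = 1 then 1 else 0, if k = 2 then 1 else 0, if k = 3 then 1 else 0]"
      have "A *v (B *v v) = v"
        by (simp add: matrix_vector_mul_assoc B)
      then have v: "(A *v (B *v v)) $ i = v $ i" for i
        by simp
      define d where "d i = (if i = 1 then (B *v v) $ 1 else if i = 2 then (B *v v) $ 2 else (B *v v) $ 3)"
        for i :: nat
      have d: "(\<Sum>i=1..3. a i 1 * d i) = (if 1 = k then 1 else 0)"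
        "(\<Sum>i=1..3. a i 2 * d i) = (if 2 = k then 1 else 0)"
        "(\<Sum>i=1..3. a i 3 * d i) = (if 3 = k then 1 else 0)"
        unfolding d_def A v by (auto simp: v_def)
      show ?thesis
      proof (intro exI ballI)
        fix j :: nat assume "j \<in> {1..3}"
        then have "j = 1 \<or> j = 2 \<or> j = 3"
          by (simp only: cases_3)
        then show "(\<Sum>i=1..3. a i j * d i) = (if j = k then 1 else 0)"
          using d by (elim disjE) (simp_all only:)
      qed
    qed
    then show thesis
      by (rule that(2))
  qed
qed

text \<open>Three columns of signs cannot exhaust the four sign patterns modulo a common sign.\<close>

lemma sign_pattern_3:
  fixes e :: "nat \<Rightarrow> nat \<Rightarrow> int"
  assumes e: "\<And>i j. i \<in> {1..3} \<Longrightarrow> j \<in> {1..3} \<Longrightarrow> e i j = 1 \<or> e i j = - 1"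
  obtains n where "\<And>i. n i \<in> {1, - 1}" "\<And>j. j \<in> {1..3} \<Longrightarrow> (\<Sum>i=1..3. e i j * n i) \<in> {1, - 1}"
proof -
  let ?B = "(\<lambda>j. (e 1 j * e 2 j, e 1 j * e 3 j)) ` {1..3}"
  have "card ?B \<le> 3"
    using card_image_le[of "{1..3::nat}" "\<lambda>j. (e 1 j * e 2 j, e 1 j * e 3 j)"] by simp
  then have "\<not> {1, - 1} \<times> {1, - 1} \<subseteq> ?B"
    using card_mono[of ?B "{1, - 1} \<times> {1, - 1}"] by (auto simp: card_cartesian_product)
  then obtain p q where pq: "p \<in> {1, - 1}" "q \<in> {1, - 1}" "(p, q) \<notin> ?B"
    by auto
  \<comment> \<open>A sum of three signs is 1 or -1 unless all three agree. For column
    \<open>j\<close> they agree only if \<open>(p, q)\<close> is the pattern of that column, which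
    was excluded.\<close>
  define n where "n i = (if i = 1 then 1 else if i = 2 then p else q)" for i :: nat
  have "(\<Sum>i=1..3. e i j * n i) \<in> {1, - 1}" if j: "j \<in> {1..3}" for j
  proof -
    have "(p, q) \<noteq> (e 1 j * e 2 j, e 1 j * e 3 j)"
      using pq j by blast
    then show ?thesis
      using pq(1,2) e[of 1 j] e[of 2 j] e[of 3 j] j unfolding sum_1_3 n_def by auto
  qed
  moreover have "n i \<in> {1, - 1}" for i
    using pq by (auto simp: n_def)
  ultimately show thesis
    by (rule that[rotated])
qed

text \<open>The adjoint of the automorphism \<open>p \<mapsto> (a * fst p, chi b e p)\<close> maps the character \<open>(s, n)\<close> to
  \<open>(a * s + b * n, e * n)\<close>.\<close>

locale independent_forms =
  fixes \<phi> :: "nat \<Rightarrow> real \<Rightarrow> int \<Rightarrow> complex"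
    and a b :: "nat \<Rightarrow> nat \<Rightarrow> real" and e :: "nat \<Rightarrow> nat \<Rightarrow> int"
  assumes cf: "\<And>j. j \<in> {1..3} \<Longrightarrow> nonvanishing_cf (\<phi> j)"
    and a_nz: "\<And>i j. i \<in> {1..3} \<Longrightarrow> j \<in> {1..3} \<Longrightarrow> a i j \<noteq> 0"
    and e: "\<And>i j. i \<in> {1..3} \<Longrightarrow> j \<in> {1..3} \<Longrightarrow> e i j = 1 \<or> e i j = - 1"
    and independent: "\<And>s n. (\<Prod>j=1..3. \<phi> j (\<Sum>i=1..3. a i j * s i + b i j * of_int (n i)) (\<Sum>i=1..3. e i j * n i)) =
      (\<Prod>i=1..3. \<Prod>j=1..3. \<phi> j (a i j * s i + b i j * of_int (n i)) (e i j * n i))"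
begin

text \<open>Along the direction the left side has modulus one, so every factor on the right, being
  at most one, has modulus one as well. Since \<open>a i j * d i\<close> is nonzero, these factors
  reach every real argument.\<close>

lemma degenerate_of_direction:
  assumes i: "i \<in> {1..3}" "d i \<noteq> 0"
    and d: "\<And>t j. j \<in> {1..3} \<Longrightarrow> cmod (\<phi> j (t * (\<Sum>i=1..3. a i j * d i)) 0) = 1"
    and j: "j \<in> {1..3}"
  shows "cmod (\<phi> j s 0) = 1"
proof -
  define t where "t = s / (a i j * d i)"
  let ?P = "\<lambda>i. \<Prod>j=1..3. cmod (\<phi> j (a i j * (t * d i)) 0)"
  have le: "cmod (\<phi> j s 0) \<le> 1" if "j \<in> {1..3}" for j s
    using nonvanishing_cf.norm_le[OF cf[OF that]] .
  have "(\<Prod>i=1..3. ?P i) = (\<Prod>j=1..3. cmod (\<phi> j (t * (\<Sum>i=1..3. a i j * d i)) 0))"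
    using arg_cong[OF independent[of "\<lambda>i. t * d i" "\<lambda>_. 0"], of cmod]
    by (simp add: prod_norm[symmetric] sum_distrib_left mult_ac)
  also have "\<dots> = 1"
    using d by (intro prod.neutral) auto
  finally have "?P i = 1"
    using le i by (intro prod_le_one_eq_one[of "{1..3}" ?P i]) (auto intro!: prod_nonneg prod_le_1)
  then have "cmod (\<phi> j (a i j * (t * d i)) 0) = 1"
    using le j by (intro prod_le_one_eq_one[of "{1..3}" "\<lambda>j. cmod (\<phi> j (a i j * (t * d i)) 0)" j]) auto
  moreover have "a i j * (t * d i) = s"
    using i a_nz[OF i(1) j] by (simp add: t_def)
  ultimately show ?thesis by simp
qed

text \<open>Moving along \<open>d\<close> changes only the \<open>k\<close>-th factor on the left of the functional equation, so
  \<open>\<phi> k (x + y + t) (m + n) / \<phi> k (x + y) (m + n)\<close> splits into a function of \<open>(x, m)\<close> and one of \<open>(y, n)\<close>.\<close>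

lemma quadratic_of_direction:
  assumes k: "k \<in> {1..3}"
    and d: "\<And>j. j \<in> {1..3} \<Longrightarrow> (\<Sum>i=1..3. a i j * d i) = (if j = k then 1 else 0)"
  shows "\<phi> k (x + y + t) (m + n) * \<phi> k t 0 * \<phi> k x m * \<phi> k y n =
    \<phi> k (x + t) m * \<phi> k (y + t) n * \<phi> k (x + y) (m + n)"
proof -
  interpret nonvanishing_cf "\<phi> k" by (rule cf[OF k])
  have nz: "\<phi> j s n \<noteq> 0" if "j \<in> {1..3}" for j s n
    using nonvanishing_cf.nonzero[OF cf[OF that]] .
  define P where "P i s n = (\<Prod>j=1..3. \<phi> j (a i j * s + b i j * of_int n) (e i j * n))" for i s n
  have P_nz: "P i s n \<noteq> 0" for i s n
    using nz by (auto simp: P_def)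
  \<comment> \<open>Chosen so that the adjoint of the automorphism with indices \<open>i\<close>,
    \<open>k\<close> sends \<open>(S i x m, e i k * m)\<close> to \<open>(x, m)\<close>; the square
    of \<open>e i k\<close> is 1.\<close>
  define S where "S i x m = (x - b i k * of_int (e i k * m)) / a i k" for i x m
  define Q where "Q i x m = P i (S i x m + t * d i) (e i k * m) / P i (S i x m) (e i k * m)" for i x m
  define D where "D x m = \<phi> k (x + t) m / \<phi> k x m" for x m
  \<comment> \<open>Form 1 carries \<open>(x, m)\<close> and form 2 carries \<open>(y, n)\<close>.
    Form 3 moves only by \<open>t * d 3\<close> and contributes a factor free of \<open>x\<close>
    and \<open>y\<close>.\<close>
  have D: "D (x + y) (m + n) = Q 1 x m * Q 2 y n * (P 3 (t * d 3) 0 / P 3 0 0)" for x y m n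
  proof -
    define s where "s i = (if i = 1 then S 1 x m else if i = 2 then S 2 y n else 0)" for i :: nat
    define N where "N i = (if i = 1 then e 1 k * m else if i = 2 then e 2 k * n else 0)" for i :: nat
    define X where "X r j = (\<Sum>i=1..3. a i j * (s i + r * d i) + b i j * of_int (N i))" for r j
    define M where "M j = (\<Sum>i=1..3. e i j * N i)" for j
    have X: "X r j = X 0 j + r * (\<Sum>i=1..3. a i j * d i)" for r j
      by (simp add: X_def sum_distrib_left distrib_left sum.distrib mult_ac)
    have "X 0 k = x + y"
      using a_nz[of 1 k] a_nz[of 2 k] k unfolding X_def sum_1_3
      by (simp add: s_def N_def S_def)
    then have X_k: "X r k = x + y + r" for r
      using X[of r k] d[OF k] by simp
    have M_k: "M k = m + n"
      using e[of 1 k] e[of 2 k] k unfolding M_def sum_1_3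
      by (auto simp: N_def)
    \<comment> \<open>The remaining factors on the left do not depend on the displacement
      \<open>r\<close>, so they cancel in the quotient of the values at \<open>r = t\<close> and
      \<open>r = 0\<close>.\<close>
    define R where "R = (\<Prod>j\<in>{1..3}-{k}. \<phi> j (X 0 j) (M j))"
    have "R \<noteq> 0"
      using nz by (auto simp: R_def)
    have *: "\<phi> k (x + y + r) (m + n) * R =
        P 1 (S 1 x m + r * d 1) (e 1 k * m) * P 2 (S 2 y n + r * d 2) (e 2 k * n) * P 3 (r * d 3) 0" for r
    proof -
      have "R = (\<Prod>j\<in>{1..3}-{k}. \<phi> j (X r j) (M j))"
        unfolding R_def by (intro prod.cong refl) (use d in \<open>simp add: X[of r]\<close>)
      then have "\<phi> k (x + y + r) (m + n) * R =
          \<phi> k (X r k) (M k) * (\<Prod>j\<in>{1..3}-{k}. \<phi> j (X r j) (M j))"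
        by (simp only: X_k M_k)
      also have "\<dots> = (\<Prod>j=1..3. \<phi> j (X r j) (M j))"
        by (rule prod.remove[symmetric]) (use k in auto)
      also have "\<dots> = (\<Prod>i=1..3. P i (s i + r * d i) (N i))"
        using independent[of "\<lambda>i. s i + r * d i" N] by (simp only: X_def M_def P_def)
      also have "\<dots> = P 1 (S 1 x m + r * d 1) (e 1 k * m) * P 2 (S 2 y n + r * d 2) (e 2 k * n) * P 3 (r * d 3) 0"
        unfolding prod_1_3 by (simp add: s_def N_def)
      finally show ?thesis .
    qed
    have "D (x + y) (m + n) = (\<phi> k (x + y + t) (m + n) * R) / (\<phi> k (x + y + 0) (m + n) * R)"
      using \<open>R \<noteq> 0\<close> by (simp add: D_def)
    then show ?thesis
      unfolding * by (simp add: Q_def)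
  qed
  \<comment> \<open>Both sides consist of the same four values of \<open>Q\<close> and the square of
    the factor from form 3. Moreover \<open>D 0 0\<close> is \<open>\<phi> k t 0\<close>.\<close>
  have "D (x + y) (m + n) * D 0 0 = D x m * D y n"
    using D[of x y m n] D[of 0 0 0 0] D[of x 0 m 0] D[of 0 y 0 n] by simp
  then show ?thesis
    by (simp add: D_def field_simps)
qed

text \<open>With \<open>G\<close> the product of the maxima, the functional equation gives \<open>G \<le> G ^ 3\<close>.\<close>

lemma norm_one_at_maxima:
  assumes le: "\<And>j s n. j \<in> {1..3} \<Longrightarrow> n \<in> {1, - 1} \<Longrightarrow> cmod (\<phi> j s n) \<le> cmod (\<phi> j (x j) 1)"
    and n: "\<And>i. n i \<in> {1, - 1}"
    and max: "\<And>j. j \<in> {1..3} \<Longrightarrow>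
      cmod (\<phi> j (\<Sum>i=1..3. a i j * s i + b i j * of_int (n i)) (\<Sum>i=1..3. e i j * n i)) = cmod (\<phi> j (x j) 1)"
    and j: "j \<in> {1..3}"
  shows "cmod (\<phi> j (x j) 1) = 1"
proof -
  define G where "G = (\<Prod>j=1..3. cmod (\<phi> j (x j) 1))"
  have nz: "\<phi> j s n \<noteq> 0" if "j \<in> {1..3}" for j s n
    using nonvanishing_cf.nonzero[OF cf[OF that]] .
  have le1: "cmod (\<phi> j s n) \<le> 1" if "j \<in> {1..3}" for j s n
    using nonvanishing_cf.norm_le[OF cf[OF that]] .
  have G: "G > 0" "G \<le> 1"
    using nz le1 unfolding G_def by (auto intro!: prod_pos prod_le_1)
  have "G = (\<Prod>j=1..3. cmod (\<phi> j (\<Sum>i=1..3. a i j * s i + b i j * of_int (n i)) (\<Sum>i=1..3. e i j * n i)))"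
    unfolding G_def by (intro prod.cong refl max[symmetric])
  also have "\<dots> = (\<Prod>i=1..3. \<Prod>j=1..3. cmod (\<phi> j (a i j * s i + b i j * of_int (n i)) (e i j * n i)))"
    using arg_cong[OF independent[of s n], of cmod] by (simp only: prod_norm)
  also have "\<dots> \<le> (\<Prod>i=1..3::nat. G)"
  proof (intro prod_mono conjI)
    fix i :: nat assume i: "i \<in> {1..3}"
    show "(\<Prod>j=1..3. cmod (\<phi> j (a i j * s i + b i j * of_int (n i)) (e i j * n i))) \<le> G"
      unfolding G_def
    proof (intro prod_mono conjI le)
      show "e i j * n i \<in> {1, - 1}" if "j \<in> {1..3}" for j
        using e[OF i that] n[of i] by auto
    qed auto
  qed (auto intro!: prod_nonneg)
  also have "\<dots> = G * G\<^sup>2"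
    unfolding prod_1_3 by (simp add: power2_eq_square)
  finally have "1 \<le> G\<^sup>2"
    using G by simp
  then have "G = 1"
    using G power2_le_imp_le[of 1 G] by simp
  then show ?thesis
    using prod_le_one_eq_one[of "{1..3}" "\<lambda>j. cmod (\<phi> j (x j) 1)" j] le1 j by (auto simp: G_def)
qed

text \<open>Here the modulus is constant on the levels 1 and -1, so every point there is a maximum
  and only the signs have to be chosen.\<close>

lemma degenerate_real_parts:
  assumes deg: "\<And>j s. j \<in> {1..3} \<Longrightarrow> cmod (\<phi> j s 0) = 1" and j: "j \<in> {1..3}"
  shows "cmod (\<phi> j 0 1) = 1"
proof -
  obtain n where n: "\<And>i. n i \<in> {1, - 1}" "\<And>j. j \<in> {1..3} \<Longrightarrow> (\<Sum>i=1..3. e i j * n i) \<in> {1, - 1}"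
    using sign_pattern_3[of e] e by blast
  have *: "cmod (\<phi> j s n) = cmod (\<phi> j 0 1)" if "j \<in> {1..3}" "n \<in> {1, - 1}" for j s n
    using nonvanishing_cf.degenerate_real_part_norm[OF cf deg] that by blast
  show ?thesis
  proof (rule norm_one_at_maxima[of "\<lambda>_. 0" n "\<lambda>_. 0"])
    show "cmod (\<phi> j s m) \<le> cmod (\<phi> j 0 1)" if "j \<in> {1..3}" "m \<in> {1, - 1}" for j s m
      using *[OF that] by (rule eq_refl)
  qed (intro * n j | assumption)+
qed

text \<open>Supplies exactly the data from which a distribution on a coset of a helix is
  reconstructed.\<close>

lemma gaussian_cf:
  assumes j: "j \<in> {1..3}"
  shows "\<exists>\<sigma> \<beta> c. \<sigma> \<ge> 0 \<and> (\<forall>s. \<phi> j s 0 = of_real (exp (- (\<sigma> * s\<^sup>2))) * cis (\<beta> * s)) \<and>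
    cmod (\<phi> j (- c) 1) = 1"
proof (cases "\<forall>j\<in>{1..3}. \<forall>s. cmod (\<phi> j s 0) = 1")
  case True
  obtain \<beta> where "\<And>s. \<phi> j s 0 = cis (\<beta> * s)"
    using nonvanishing_cf.degenerate_real_part[OF cf[OF j]] True j by blast
  moreover have "cmod (\<phi> j 0 1) = 1"
    using degenerate_real_parts True j by blast
  ultimately show ?thesis
    by (intro exI[of _ 0] exI[of _ \<beta>]) simp
next
  case False
  \<comment> \<open>Once some factor is nondegenerate on the real line, no nonzero direction keeps
    all left factors at modulus one. This also excludes a singular matrix.\<close>
  have no_direction: "(\<forall>j\<in>{1..3}. \<forall>t. cmod (\<phi> j (t * (\<Sum>i=1..3. a i j * d i)) 0) = 1) \<longrightarrow> d i = 0"
    if "i \<in> {1..3}" for d i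
    using False degenerate_of_direction[OF that, of d] by blast
  show ?thesis
  proof (rule singular_or_invertible_3[of a])
    fix d i assume "i \<in> {1..3}" "d i \<noteq> 0" "\<And>j. j \<in> {1..3} \<Longrightarrow> (\<Sum>i=1..3. a i j * d i) = 0"
    then have False
      using no_direction[of i d] nonvanishing_cf.at_0[OF cf] by simp
    then show ?thesis ..
  next
    assume "\<And>k. k \<in> {1..3} \<Longrightarrow>
      \<exists>d. \<forall>j\<in>{1..3}. (\<Sum>i=1..3. a i j * d i) = (if j = k then 1 else 0)"
    then obtain d where d: "\<And>j k. k \<in> {1..3} \<Longrightarrow> j \<in> {1..3} \<Longrightarrow>
        (\<Sum>i=1..3. a i j * d k i) = (if j = k then 1 else 0)"
      by metis
    have quad: "\<phi> k (x + y + t) (m + n) * \<phi> k t 0 * \<phi> k x m * \<phi> k y n =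
        \<phi> k (x + t) m * \<phi> k (y + t) n * \<phi> k (x + y) (m + n)" if "k \<in> {1..3}" for k x y t m n
      using quadratic_of_direction[OF that d[OF that]] .
    have "\<exists>\<sigma> \<beta>. \<sigma> \<ge> 0 \<and> (\<forall>s. \<phi> k s 0 = of_real (exp (- (\<sigma> * s\<^sup>2))) * cis (\<beta> * s))"
      if "k \<in> {1..3}" for k
      using nonvanishing_cf.quadratic_real_part[OF cf[OF that] quad[OF that]] by metis
    then obtain \<sigma> \<beta> where \<sigma>: "\<And>k. k \<in> {1..3} \<Longrightarrow> \<sigma> k \<ge> 0"
      and \<phi>: "\<And>k s. k \<in> {1..3} \<Longrightarrow> \<phi> k s 0 = of_real (exp (- (\<sigma> k * s\<^sup>2))) * cis (\<beta> k * s)"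
      by metis
    have norm: "cmod (\<phi> k s 0) = exp (- (\<sigma> k * s\<^sup>2))" if "k \<in> {1..3}" for k s
      by (simp add: \<phi>[OF that] norm_mult)
    \<comment> \<open>If \<open>\<sigma> k\<close> were zero, moving along \<open>d k\<close> would
      change only the \<open>k\<close>-th factor, and that one keeps modulus one.\<close>
    have pos: "\<sigma> k > 0" if k: "k \<in> {1..3}" for k
    proof (rule ccontr)
      assume "\<not> \<sigma> k > 0"
      then have "\<sigma> k = 0" using \<sigma>[OF k] by simp
      then have "cmod (\<phi> j (t * (\<Sum>i=1..3. a i j * d k i)) 0) = 1" if "j \<in> {1..3}" for j t
        using norm[OF that] d[OF k that] by (cases "j = k") simp_all
      then have "d k i = 0" if "i \<in> {1..3}" for i
        using no_direction[OF that] by blast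
      then show False
        using d[OF k k] by simp
    qed
    have "\<exists>c. (\<forall>n\<in>{1, - 1}. \<forall>s. cmod (\<phi> k s n) \<le> cmod (\<phi> k (- c) 1)) \<and>
        (\<forall>n\<in>{1, - 1}. cmod (\<phi> k (- (c * of_int n)) n) = cmod (\<phi> k (- c) 1))" if "k \<in> {1..3}" for k
      using nonvanishing_cf.quadratic_norm_maximum[OF cf[OF that] quad[OF that] pos[OF that] norm[OF that]]
      by metis
    then obtain c where c_le: "\<And>k s n. k \<in> {1..3} \<Longrightarrow> n \<in> {1, - 1} \<Longrightarrow> cmod (\<phi> k s n) \<le> cmod (\<phi> k (- c k) 1)"
      and c_eq: "\<And>k n. k \<in> {1..3} \<Longrightarrow> n \<in> {1, - 1} \<Longrightarrow>
        cmod (\<phi> k (- (c k * of_int n)) n) = cmod (\<phi> k (- c k) 1)"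
      by metis
    obtain n where n: "\<And>i. n i \<in> {1, - 1}" "\<And>j. j \<in> {1..3} \<Longrightarrow> (\<Sum>i=1..3. e i j * n i) \<in> {1, - 1}"
      using sign_pattern_3[of e] e by blast
    \<comment> \<open>\<open>r j\<close> is the real argument that puts the \<open>j\<close>-th left
      factor at its maximum, corrected for the contribution of the integers \<open>n i\<close>. The
      vector \<open>s\<close> then solves the linear system by superposing the directions
      \<open>d k\<close>.\<close>
    define r where "r j = - (c j * of_int (\<Sum>i=1..3. e i j * n i)) - (\<Sum>i=1..3. b i j * of_int (n i))" for j
    define s where "s i = (\<Sum>k=1..3. r k * d k i)" for i
    have "(\<Sum>i=1..3. a i j * s i) = r j" if "j \<in> {1..3}" for j
    proof -
      have "(\<Sum>i=1..3. a i j * s i) = (\<Sum>k=1..3. r k * (\<Sum>i=1..3. a i j * d k i))"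
        unfolding s_def sum_distrib_left by (subst sum.swap) (simp add: mult_ac)
      also have "\<dots> = (\<Sum>k=1..3. if k = j then r k else 0)"
        using d that by (intro sum.cong) auto
      finally show ?thesis
        using that by simp
    qed
    then have "(\<Sum>i=1..3. a i j * s i + b i j * of_int (n i)) = - (c j * of_int (\<Sum>i=1..3. e i j * n i))"
      if "j \<in> {1..3}" for j
      using that by (simp only: sum.distrib) (simp add: r_def)
    then have "cmod (\<phi> j (\<Sum>i=1..3. a i j * s i + b i j * of_int (n i)) (\<Sum>i=1..3. e i j * n i)) =
        cmod (\<phi> j (- c j) 1)" if "j \<in> {1..3}" for j
      using c_eq[OF that n(2)[OF that]] that by (simp only:)
    then have "cmod (\<phi> j (- c j) 1) = 1"
      by (intro norm_one_at_maxima[of "\<lambda>j. - c j" n s, OF c_le n(1) _ j])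
    then show ?thesis
      using \<sigma>[OF j] \<phi>[OF j] by blast
  qed
qed

end

subsection \<open>Independence of the linear forms\<close>

lemma (in real_circle_distribution) nonvanishing_cf:
  assumes "\<And>s n. cf \<mu> s n \<noteq> 0"
  shows "nonvanishing_cf (cf \<mu>)"
  by unfold_locales
    (use assms norm_cf_le cf_minus continuous_on_cf cf_add_of_norm_one in auto)

lemma chi_affine: "chi s n (a * fst p, chi b e p) = chi (a * s + b * of_int n) (e * n) p"
proof (rule circle_eqI)
  have "cis ((a * s + b * of_int n) * fst p) = cis (s * (a * fst p)) * cis (of_int n * (b * fst p))"
    by (simp add: cis_mult algebra_simps)
  then show "cval (chi s n (a * fst p, chi b e p)) = cval (chi (a * s + b * of_int n) (e * n) p)"
    by (simp add: power_int_mult_distrib cis_power_int power_int_mult mult.assoc)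
qed

lemma cval_chi_sum: "cval (chi s n (\<Sum>j\<in>A. x j)) = (\<Prod>j\<in>A. cval (chi s n (x j)))"
proof (induction A rule: infinite_finite_induct)
  case (insert j A)
  have "cval (chi s n (x j + sum x A)) = cval (chi s n (x j)) * cval (chi s n (sum x A))"
    by (rule additive_cval) (use chi_in_characters in \<open>simp add: characters_def\<close>)
  with insert show ?case
    by (simp del: cval_chi)
qed simp_all

lemma prod_cval_chi:
  "(\<Prod>i\<in>A. cval (chi (s i) (n i) p)) = cval (chi (\<Sum>i\<in>A. s i) (\<Sum>i\<in>A. n i) p)"
proof (induction A rule: infinite_finite_induct)
  case (insert i A)
  then show ?case
    by (simp add: chi_add del: cval_chi)
qed simp_all

text \<open>Characters are bounded, so independence factorises the expectation. It is applied both
  to the variables and to the linear forms.\<close>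

lemma (in prob_space) integral_prod_chi:
  fixes X :: "'b \<Rightarrow> 'a \<Rightarrow> real \<times> circle"
  assumes "finite I" and indep: "indep_vars (\<lambda>_. borel) X I"
  shows "(LINT \<omega>|M. (\<Prod>i\<in>I. cval (chi (s i) (n i) (X i \<omega>)))) =
    (\<Prod>i\<in>I. cf (distr M borel (X i)) (s i) (n i))"
proof -
  have X: "X i \<in> borel_measurable M" if "i \<in> I" for i
    using indep that by (auto simp: indep_vars_def)
  have indep': "indep_vars (\<lambda>_. borel) (\<lambda>i \<omega>. cval (chi (s i) (n i) (X i \<omega>))) I"
    by (rule indep_vars_compose2[OF indep]) (rule measurable_cval_chi)
  have "(LINT \<omega>|M. (\<Prod>i\<in>I. cval (chi (s i) (n i) (X i \<omega>)))) =
      (\<Prod>i\<in>I. (LINT \<omega>|M. cval (chi (s i) (n i) (X i \<omega>))))"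
  proof (rule indep_vars_lebesgue_integral[OF \<open>finite I\<close> indep'])
    show "integrable M (\<lambda>\<omega>. cval (chi (s i) (n i) (X i \<omega>)))" if "i \<in> I" for i
      by (rule integrable_const_bound[where B = 1])
        (use measurable_compose[OF X[OF that] measurable_cval_chi] in \<open>auto simp del: cval_chi\<close>)
  qed
  also have "\<dots> = (\<Prod>i\<in>I. cf (distr M borel (X i)) (s i) (n i))"
    unfolding cf_def char_function_def
    by (intro prod.cong refl integral_distr[symmetric] X measurable_cval_chi)
  finally show ?thesis .
qed

theorem theorem1:
  fixes \<alpha> :: "nat \<Rightarrow> nat \<Rightarrow> real \<times> circle \<Rightarrow> real \<times> circle"
    and M :: "'w measure"
    and \<xi> :: "nat \<Rightarrow> 'w \<Rightarrow> real \<times> circle"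
    and \<mu> :: "nat \<Rightarrow> (real \<times> circle) measure"
    and L :: "nat \<Rightarrow> 'w \<Rightarrow> real \<times> circle"
  assumes \<alpha>: "\<And>i j. i \<in> {1..3} \<Longrightarrow> j \<in> {1..3} \<Longrightarrow> \<alpha> i j \<in> topological_Aut"
    and M: "prob_space M"
    and \<xi>: "prob_space.indep_vars M (\<lambda>_. borel) \<xi> {1..3}"
    and \<mu>: "\<And>j. j \<in> {1..3} \<Longrightarrow> \<mu> j = distr M borel (\<xi> j)"
    and nonvanishing: "\<And>j y. j \<in> {1..3} \<Longrightarrow> y \<in> characters \<Longrightarrow> char_function (\<mu> j) y \<noteq> 0"
    and L: "\<And>i. i \<in> {1..3} \<Longrightarrow> L i = (\<lambda>\<omega>. \<Sum>j=1..3. \<alpha> i j (\<xi> j \<omega>))"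
    and indep_L: "prob_space.indep_vars M (\<lambda>_. borel) L {1..3}"
  shows "\<forall>j\<in>{1..3}. degenerate (\<mu> j) \<or>
           (gaussian (\<mu> j) \<and>
            (\<exists>G. add_subgroup G \<and> topologically_isomorphic G (UNIV :: real set) \<and>
                 is_coset_of (measure_support (\<mu> j)) G))"
proof -
  interpret M: prob_space M by (rule M)
  have \<xi>_meas: "\<xi> j \<in> borel_measurable M" if "j \<in> {1..3}" for j
    using \<xi> that by (auto simp: M.indep_vars_def)
  have distr: "real_circle_distribution (\<mu> j)" if "j \<in> {1..3}" for j
    unfolding real_circle_distribution_def real_circle_distribution_axioms_def \<mu>[OF that]
    by (intro conjI M.prob_space_distr \<xi>_meas that) simp
  define P where "P f a b e \<longleftrightarrow> a \<noteq> 0 \<and> (e = 1 \<or> e = - 1) \<and> (\<forall>p. f p = (a * fst p, chi b e p))"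
    for f a b e
  have "\<exists>a b e. P (\<alpha> i j) a b e" if "i \<in> {1..3}" "j \<in> {1..3}" for i j
    using that unfolding P_def by (intro topological_Aut_real_circle \<alpha>)
  then obtain a b e
    where P: "\<And>i j. i \<in> {1..3} \<Longrightarrow> j \<in> {1..3} \<Longrightarrow> P (\<alpha> i j) (a i j) (b i j) (e i j)"
    by metis
  have a: "a i j \<noteq> 0" and e: "e i j = 1 \<or> e i j = - 1"
    and \<alpha>_eq: "\<alpha> i j p = (a i j * fst p, chi (b i j) (e i j) p)"
    if "i \<in> {1..3}" "j \<in> {1..3}" for i j p
    using P[OF that] by (simp_all only: P_def simp_thms)
  have chi_L: "cval (chi s n (L i \<omega>)) =
      (\<Prod>j=1..3. cval (chi (a i j * s + b i j * of_int n) (e i j * n) (\<xi> j \<omega>)))"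
    if "i \<in> {1..3}" for i s n \<omega>
    unfolding L[OF that] cval_chi_sum
    by (intro prod.cong refl) (simp only: \<alpha>_eq[OF that] chi_affine)
  have cf_eq: "cf (distr M borel (\<xi> j)) = cf (\<mu> j)" if "j \<in> {1..3}" for j
    by (simp only: \<mu>[OF that])
  interpret independent_forms "\<lambda>j. cf (\<mu> j)" a b e
  proof (rule independent_forms.intro)
    show "nonvanishing_cf (cf (\<mu> j))" if "j \<in> {1..3}" for j
      by (rule real_circle_distribution.nonvanishing_cf[OF distr[OF that]])
        (use nonvanishing[OF that] chi_in_characters in \<open>simp add: cf_def\<close>)
    fix s :: "nat \<Rightarrow> real" and n :: "nat \<Rightarrow> int"
    let ?A = "\<lambda>i j. a i j * s i + b i j * of_int (n i)" and ?N = "\<lambda>i j. e i j * n i"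
    \<comment> \<open>The joint characteristic function of the forms is computed in two ways:
      grouped by \<open>j\<close> it factors by independence of the \<xi>, grouped by
      \<open>i\<close> by independence of the \<open>L\<close>, after which each form is split by
      independence of the \<xi> again.\<close>
    have "(\<Prod>j=1..3. cf (\<mu> j) (\<Sum>i=1..3. ?A i j) (\<Sum>i=1..3. ?N i j)) =
        (LINT \<omega>|M. (\<Prod>j=1..3. cval (chi (\<Sum>i=1..3. ?A i j) (\<Sum>i=1..3. ?N i j) (\<xi> j \<omega>))))"
      unfolding M.integral_prod_chi[OF finite_atLeastAtMost \<xi>]
      by (intro prod.cong refl) (simp only: cf_eq)
    also have "\<dots> = (LINT \<omega>|M. (\<Prod>j=1..3. \<Prod>i=1..3. cval (chi (?A i j) (?N i j) (\<xi> j \<omega>))))"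
      by (simp only: prod_cval_chi)
    also have "\<dots> = (LINT \<omega>|M. (\<Prod>i=1..3. \<Prod>j=1..3. cval (chi (?A i j) (?N i j) (\<xi> j \<omega>))))"
      by (subst prod.swap) (rule refl)
    also have "\<dots> = (LINT \<omega>|M. (\<Prod>i=1..3. cval (chi (s i) (n i) (L i \<omega>))))"
      by (intro Bochner_Integration.integral_cong prod.cong refl chi_L[symmetric])
    also have "\<dots> = (\<Prod>i=1..3. (LINT \<omega>|M. cval (chi (s i) (n i) (L i \<omega>))))"
    proof -
      have "L i \<in> borel_measurable M" if "i \<in> {1..3}" for i
        using indep_L that by (auto simp: M.indep_vars_def)
      then show ?thesis
        unfolding M.integral_prod_chi[OF finite_atLeastAtMost indep_L]
        unfolding cf_def char_function_def
        by (intro prod.cong refl integral_distr measurable_cval_chi)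
    qed
    also have "\<dots> = (\<Prod>i=1..3. (LINT \<omega>|M. (\<Prod>j=1..3. cval (chi (?A i j) (?N i j) (\<xi> j \<omega>)))))"
      by (intro Bochner_Integration.integral_cong prod.cong refl chi_L)
    also have "\<dots> = (\<Prod>i=1..3. \<Prod>j=1..3. cf (\<mu> j) (?A i j) (?N i j))"
      unfolding M.integral_prod_chi[OF finite_atLeastAtMost \<xi>]
      by (intro prod.cong refl) (simp only: cf_eq)
    finally show "(\<Prod>j=1..3. cf (\<mu> j) (\<Sum>i=1..3. ?A i j) (\<Sum>i=1..3. ?N i j)) =
        (\<Prod>i=1..3. \<Prod>j=1..3. cf (\<mu> j) (?A i j) (?N i j))" .
  qed (use a e in auto)
  show ?thesis
  proof
    fix j :: nat assume j: "j \<in> {1..3}"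
    obtain \<sigma> \<beta> c where "\<sigma> \<ge> 0" "\<And>s. cf (\<mu> j) s 0 = of_real (exp (- (\<sigma> * s\<^sup>2))) * cis (\<beta> * s)"
      "cmod (cf (\<mu> j) (- c) 1) = 1"
      using gaussian_cf[OF j] by blast
    then show "degenerate (\<mu> j) \<or> (gaussian (\<mu> j) \<and>
        (\<exists>G. add_subgroup G \<and> topologically_isomorphic G (UNIV :: real set) \<and>
             is_coset_of (measure_support (\<mu> j)) G))"
      by (intro real_circle_distribution.degenerate_or_gaussian_helix[OF distr[OF j]])
  qed
qed

end
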